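(* Let $H$ be a real Hilbert space and let $J:H\to\mathbb{R}$ be twice continuously Fréchet differentiable with a global minimizer $x^*\in H$. Suppose that for some constant $L>0$ $$\|J''(x)-J''(y)\|_{L(H)}\le L\|x-y\|,\quad x,y\in H.$$ Let $\xi\in H$ and suppose that $w\in H$ satisfies $x^*-\xi=J''(x^* )w$ and $L\|w\|<t_0$, where $t_0\approx0.316$ is the positive root of $8t^3+18t^2+3t-3=0$. Put $$\widehat C_0=\frac{1}{1-L\|w\|}\left(L\|w\|^2+\sqrt{L^2\|w\|^4+(1-L\|w\|)\left(4\|w\|^2+\tfrac{8}{3}L\|w\|^3\right)}\right),$$ let $\varkappa$ satisfy $\widehat C_0<\varkappa<\frac{2}{L}-\widehat C_0$ (such $\varkappa$ exist), and fix $\bar\alpha>0$, $\mu>0$, $\alpha_0>0$, $0<s<2/5$. Set $$C_4=2-L(\varkappa+\widehat C_0),\quad C_6=1+\|x^*-\xi\|+\widehat C_0\bar\alpha,\quad C_7=1+\|x^*-\xi\|+(\varkappa+\widehat C_0)\bar\alpha .$$ Then there is $k_0\in\mathbb{N}$, independent of $\delta$ (and of $J_\delta$), such that for every integer $k\ge k_0$ the following holds with $\alpha_n=\alpha_0(n+k)^{-s}$, $n\in\mathbb{N}$. Let $\delta\ge0$ and let $J_\delta:H\to\mathbb{R}$ be twice continuously Fréchet differentiable with $$\|J_\delta'(x)-J'(x)\|\le\delta(1+\|x-\xi\|),\quad \|J_\delta''(x)-J''(x)\|_{L(H)}\le\delta(1+\|x-\xi\|),\quad x\in H$$ ($J_\delta=J$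 if $\delta=0$). Let $x_1\in H$ satisfy $$\|x_1-x^*\|\le(\varkappa-\widehat C_0)\alpha_1,$$ and define $$x_{n+1}=x_n-\mu\alpha_n\bigl(J_\delta'(x_n)+2\alpha_n(x_n-\xi)\bigr),\quad n\in\mathbb{N}.$$ (i) If $\delta=0$, then $\|x_n-x^*\|\le(\varkappa+\widehat C_0)\alpha_n$ for all $n\in\mathbb{N}$. (ii) If $\delta>0$ and the stopping index is $N=\min\{n\ge1\mid\alpha_n\le K_1\sqrt\delta\}$, where $$K_1\ge\sqrt{\max\left\{\frac{2C_7\bar\alpha}{C_4},\frac{4C_6}{\varkappa C_4}\right\}},$$ then $\|x_N-x^*\|\le(\varkappa+\widehat C_0)K_1\sqrt\delta$.
   Context: $\|\cdot\|$ is the norm of $H$ and $\|\cdot\|_{L(H)}$ is the operator norm on bounded linear operators on $H$. First derivatives $J'(x),J_\delta'(x)\in H$ are gradients and second Fréchet derivatives are self-adjoint operators in $L(H)$, via the Riesz identification. $\mathbb{N}=\{1,2,\dots\}$. *)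

theory Defs
  imports "HOL-Analysis.Analysis"
begin

(* J is twice continuously Frechet differentiable on the Hilbert space, with gradient J' and
   second derivative J'' (both under the Riesz identification of the space with its dual).
   J' and J'' are uniquely determined by J.  The norm on the type of bounded linear operators
   is the operator norm; self-adjointness of J'' x is not required separately, because it
   follows from the symmetry of second derivatives. *)
definition C2_gradient ::
  "('a::{real_inner,complete_space} \<Rightarrow> real) \<Rightarrow> ('a \<Rightarrow> 'a) \<Rightarrow> ('a \<Rightarrow> 'a \<Rightarrow>\<^sub>L 'a) \<Rightarrow> bool" where
  "C2_gradient J J' J'' \<longleftrightarrow>
     (\<forall>x. (J has_derivative (\<lambda>h. inner (J' x) h)) (at x)) \<and>
     (\<forall>x. (J' has_derivative blinfun_apply (J'' x)) (at x)) \<and>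
     continuous_on UNIV J''"

definition C0_hat :: "real \<Rightarrow> 'a::real_normed_vector \<Rightarrow> real" where
  "C0_hat L w = 1 / (1 - L * norm w) *
     (L * norm w ^ 2 +
      sqrt (L ^ 2 * norm w ^ 4
            + (1 - L * norm w) * (4 * norm w ^ 2 + 8 / 3 * L * norm w ^ 3)))"

definition C4 :: "real \<Rightarrow> real \<Rightarrow> real \<Rightarrow> real" where
  "C4 L \<kappa> C0 = 2 - L * (\<kappa> + C0)"

definition C6 :: "'a::real_normed_vector \<Rightarrow> 'a \<Rightarrow> real \<Rightarrow> real \<Rightarrow> real" where
  "C6 xstar \<xi> C0 \<alpha>bar = 1 + norm (xstar - \<xi>) + C0 * \<alpha>bar"

definition C7 :: "'a::real_normed_vector \<Rightarrow> 'a \<Rightarrow> real \<Rightarrow> real \<Rightarrow> real \<Rightarrow> real" where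
  "C7 xstar \<xi> \<kappa> C0 \<alpha>bar = 1 + norm (xstar - \<xi>) + (\<kappa> + C0) * \<alpha>bar"

definition reg_param :: "real \<Rightarrow> real \<Rightarrow> nat \<Rightarrow> nat \<Rightarrow> real" where
  "reg_param \<alpha>0 s k n = \<alpha>0 * real (n + k) powr (- s)"

(* Iterates are indexed from 1, so the value x 0 is irrelevant. *)
definition reg_gradient_iteration ::
  "('a::real_normed_vector \<Rightarrow> 'a) \<Rightarrow> 'a \<Rightarrow> real \<Rightarrow> (nat \<Rightarrow> real) \<Rightarrow> (nat \<Rightarrow> 'a) \<Rightarrow> bool" where
  "reg_gradient_iteration G \<xi> \<mu> \<alpha> x \<longleftrightarrow>
     (\<forall>n\<ge>1. x (n + 1) = x n - (\<mu> * \<alpha> n) *\<^sub>R (G (x n) + (2 * \<alpha> n) *\<^sub>R (x n - \<xi>)))"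

end

theory Submission
  imports Defs
begin

text \<open>
  Since \<open>J''\<close> is Lipschitz and \<open>J'' xstar \<ge> 0\<close>, the Tikhonov functional
  \<open>J x + \<alpha> * norm (x - \<xi>)^2\<close> is strongly convex on the ball of radius \<open>\<alpha> / L\<close> about
  \<open>xstar\<close>. Comparing its minimizer over that ball with \<open>xstar - 2 \<alpha> w\<close> by third order Taylor
  estimates gives the quadratic inequality whose positive root is \<open>C0\<close>; as \<open>L C0 < 1\<close>, the
  minimizer is an interior stationary point \<open>x(\<alpha>)\<close> with
  \<open>norm (x(\<alpha>) - xstar) \<le> C0 \<alpha>\<close>.

  One gradient step contracts towards \<open>x(\<alpha>)\<close> by the factor \<open>1 - \<mu> C4 \<alpha>^2\<close>, so it gains
  \<open>\<mu> C4 \<kappa> \<alpha>^3\<close> at distance \<open>\<kappa> \<alpha>\<close>. The stopping rule keeps the contribution of the noise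
  below three quarters of this gain. The source condition gives
  \<open>norm (x(\<alpha>) - x(\<beta>)) = O((\<alpha> - \<beta>) / sqrt \<alpha>)\<close>, and for \<open>\<alpha>_n ~ n^(-s)\<close> this bound is
  \<open>o(\<alpha>_n^3)\<close> exactly when \<open>s < 2/5\<close>. Hence
  \<open>norm (x_n - x(\<alpha>_n)) \<le> \<kappa> \<alpha>_n\<close> is preserved up to the stopping index.
\<close>

section \<open>Symmetric forms, strongly convex minimization, and strong monotonicity\<close>

lemma abs_inner_le:
  assumes "norm a \<le> c"
  shows "\<bar>a \<bullet> k\<bar> \<le> c * norm k"
  using Cauchy_Schwarz_ineq2[of a k] mult_right_mono[OF assms norm_ge_zero[of k]] by linarith

text \<open>Polarization: \<open>4 * (S x \<bullet> y)\<close> is the difference of the forms at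
  \<open>x + y\<close> and \<open>x - y\<close>, and the parallelogram law bounds it. The vectors
  \<open>x\<close> and \<open>y\<close> are \<open>h\<close> and \<open>S h\<close> rescaled to the
  common norm \<open>a * b\<close>, which makes the estimate lossless.\<close>

lemma norm_le_if_symmetric_form_le:
  fixes S :: "'a::real_inner \<Rightarrow> 'a"
  assumes "linear S"
    and sym: "\<And>u v. S u \<bullet> v = S v \<bullet> u"
    and bnd: "\<And>h. \<bar>S h \<bullet> h\<bar> \<le> c * (norm h)\<^sup>2"
  shows "norm (S h) \<le> c * norm h"
proof (cases "h = 0 \<or> S h = 0")
  case True
  have "0 \<le> c" if "h \<noteq> 0"
  proof -
    have "0 \<le> c * (norm h)\<^sup>2"
      using bnd[of h] by linarith
    then show ?thesis
      using that by (simp add: zero_le_mult_iff)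
  qed
  then show ?thesis
    using True linear_0[OF \<open>linear S\<close>] by (cases "h = 0") auto
next
  case False
  interpret linear S by fact
  define a b where "a = norm h" and "b = norm (S h)"
  define x y where "x = b *\<^sub>R h" and "y = a *\<^sub>R S h"
  have "a > 0" "b > 0"
    using False by (auto simp: a_def b_def)
  have "4 * (S x \<bullet> y) = S (x + y) \<bullet> (x + y) - S (x - y) \<bullet> (x - y)"
    using sym[of x y] by (simp add: add diff inner_simps)
  also have "\<dots> \<le> c * (norm (x + y))\<^sup>2 + c * (norm (x - y))\<^sup>2"
    using bnd[of "x + y"] bnd[of "x - y"] by linarith
  also have "\<dots> = 2 * c * ((norm x)\<^sup>2 + (norm y)\<^sup>2)"
    by (simp add: power2_norm_eq_inner inner_simps inner_commute algebra_simps)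
  finally have "4 * (S x \<bullet> y) \<le> 2 * c * ((norm x)\<^sup>2 + (norm y)\<^sup>2)" .
  moreover have "S x \<bullet> y = a * b * b\<^sup>2"
    by (simp add: x_def y_def scale power2_norm_eq_inner b_def)
  moreover have "(norm x)\<^sup>2 = a\<^sup>2 * b\<^sup>2" "(norm y)\<^sup>2 = a\<^sup>2 * b\<^sup>2"
    by (simp_all add: x_def y_def a_def b_def power_mult_distrib)
  ultimately have "(a * b\<^sup>2) * b \<le> (a * b\<^sup>2) * (c * a)"
    by (simp only:) (simp add: power2_eq_square algebra_simps)
  then show ?thesis
    using \<open>a > 0\<close> \<open>b > 0\<close> unfolding a_def[symmetric] b_def[symmetric] by simp
qed

text \<open>Replaces compactness, which balls of an infinite-dimensional space lack. The value at a
  midpoint cannot drop below the infimum, so the gain \<open>c * (norm (x - y))\<^sup>2\<close>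
  forces every minimizing sequence to be Cauchy.\<close>

lemma exists_minimizer_of_midpoint_convex:
  fixes f :: "'a::{real_normed_vector,complete_space} \<Rightarrow> real"
  assumes "closed S" "S \<noteq> {}" and cont: "continuous_on S f"
    and lower: "\<And>x. x \<in> S \<Longrightarrow> B \<le> f x" and "c > 0"
    and mid_in: "\<And>x y. x \<in> S \<Longrightarrow> y \<in> S \<Longrightarrow> midpoint x y \<in> S"
    and mid: "\<And>x y. x \<in> S \<Longrightarrow> y \<in> S \<Longrightarrow>
      f (midpoint x y) \<le> (f x + f y) / 2 - c * (norm (x - y))\<^sup>2"
  shows "\<exists>u\<in>S. \<forall>y\<in>S. f u \<le> f y"
proof -
  define I where "I = Inf (f ` S)"
  have bdd: "bdd_below (f ` S)"
    using lower by (auto intro!: bdd_belowI[of _ B])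
  have I_le: "I \<le> f x" if "x \<in> S" for x
    unfolding I_def using that bdd by (auto intro: cInf_lower)
  have "\<exists>x\<in>S. f x < I + 1 / (real n + 1)" for n :: nat
    using cInf_lessD[of "f ` S" "I + 1 / (real n + 1)"] \<open>S \<noteq> {}\<close> unfolding I_def by auto
  then obtain x where x: "\<And>n. x n \<in> S" "\<And>n. f (x n) < I + 1 / (real n + 1)"
    by metis
  have "Cauchy x"
  proof (rule metric_CauchyI)
    fix e :: real assume "e > 0"
    then obtain M where M: "1 / (real M + 1) < c * e\<^sup>2"
      using reals_Archimedean[of "c * e\<^sup>2"] \<open>c > 0\<close> by (auto simp: field_simps)
    have "dist (x m) (x n) < e" if "m \<ge> M" "n \<ge> M" for m n
    proof -
      have le: "1 / (real k + 1) \<le> 1 / (real M + 1)" if "k \<ge> M" for k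
        using that by (intro divide_left_mono) auto
      have "I \<le> f (midpoint (x m) (x n))"
        using I_le mid_in x by blast
      moreover have "f (x m) \<le> I + 1 / (real M + 1)" "f (x n) \<le> I + 1 / (real M + 1)"
        using x(2)[of m] x(2)[of n] le[OF that(1)] le[OF that(2)] by linarith+
      ultimately have "c * (norm (x m - x n))\<^sup>2 \<le> 1 / (real M + 1)"
        using mid[OF x(1)[of m] x(1)[of n]] by argo
      then have "c * (norm (x m - x n))\<^sup>2 < c * e\<^sup>2"
        using M by linarith
      then have "(norm (x m - x n))\<^sup>2 < e\<^sup>2"
        using \<open>c > 0\<close> by simp
      then show ?thesis
        using \<open>e > 0\<close> by (simp add: dist_norm power2_less_imp_less)
    qed
    then show "\<exists>M. \<forall>m\<ge>M. \<forall>n\<ge>M. dist (x m) (x n) < e" by blast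
  qed
  then obtain u where u: "x \<longlonglongrightarrow> u"
    using Cauchy_convergent unfolding convergent_def by blast
  then have "u \<in> S"
    using \<open>closed S\<close> x by (auto simp: closed_sequential_limits)
  have "(\<lambda>n. f (x n)) \<longlonglongrightarrow> f u"
    using cont u \<open>u \<in> S\<close> x by (auto simp: continuous_on_sequentially o_def)
  moreover have "(\<lambda>n. I + 1 / (real n + 1)) \<longlonglongrightarrow> I"
    using tendsto_add[OF tendsto_const LIMSEQ_inverse_real_of_nat, of I]
    by (simp add: inverse_eq_divide add.commute)
  ultimately have "f u \<le> I"
    by (rule LIMSEQ_le) (use x(2) less_imp_le in blast)
  then show ?thesis
    using I_le \<open>u \<in> S\<close> by force
qed

text \<open>Along the segment from \<open>x\<close> to \<open>y\<close>, \<open>\<phi>\<close> is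
  \<open>f\<close> minus the linear and quadratic terms of the claimed bound. Strong monotonicity
  between \<open>x\<close> and \<open>x + t d\<close>, divided by \<open>t\<close>, makes its
  derivative nonnegative.\<close>

lemma strong_monotone_imp_lower_quadratic:
  fixes f :: "'a::real_inner \<Rightarrow> real"
  assumes "convex S" "x \<in> S" "y \<in> S"
    and der: "\<And>x. (f has_derivative (\<lambda>h. G x \<bullet> h)) (at x)"
    and mono: "\<And>x y. x \<in> S \<Longrightarrow> y \<in> S \<Longrightarrow> (G y - G x) \<bullet> (y - x) \<ge> m * (norm (y - x))\<^sup>2"
  shows "f y \<ge> f x + G x \<bullet> (y - x) + m / 2 * (norm (y - x))\<^sup>2"
proof -
  define d where "d = y - x"
  define \<phi> where "\<phi> t = f (x + t *\<^sub>R d) - t * (G x \<bullet> d) - m / 2 * t\<^sup>2 * (norm d)\<^sup>2" for t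
  have in_S: "x + t *\<^sub>R d \<in> S" if "0 \<le> t" "t \<le> 1" for t
  proof -
    have "x + t *\<^sub>R d = (1 - t) *\<^sub>R x + t *\<^sub>R y"
      by (simp add: d_def algebra_simps)
    then show ?thesis
      using convexD_alt[OF \<open>convex S\<close> \<open>x \<in> S\<close> \<open>y \<in> S\<close> that] by simp
  qed
  have "(\<phi> has_real_derivative ((G (x + t *\<^sub>R d) - G x) \<bullet> d - m * t * (norm d)\<^sup>2)) (at t)" for t
    unfolding \<phi>_def has_field_derivative_def
    by (rule derivative_eq_intros has_derivative_compose[OF _ der] refl
       | simp add: inner_simps fun_eq_iff algebra_simps power2_eq_square)+
  moreover have "(G (x + t *\<^sub>R d) - G x) \<bullet> d - m * t * (norm d)\<^sup>2 \<ge> 0" if "0 \<le> t" "t \<le> 1" for t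
  proof (cases "t = 0")
    case False
    then have "t > 0" using that by simp
    have "t * (m * t * (norm d)\<^sup>2) \<le> t * ((G (x + t *\<^sub>R d) - G x) \<bullet> d)"
      using mono[OF \<open>x \<in> S\<close> in_S[OF that]] by (simp add: power_mult_distrib power2_eq_square ac_simps)
    then show ?thesis
      using \<open>t > 0\<close> by simp
  qed simp
  ultimately have "\<phi> 0 \<le> \<phi> 1"
    by (intro DERIV_nonneg_imp_nondecreasing[OF zero_le_one]) blast
  then show ?thesis
    by (simp add: \<phi>_def d_def)
qed

section \<open>Functionals with Lipschitz continuous second derivative\<close>

locale lipschitz_hessian =
  fixes J :: "'a::{real_inner,complete_space} \<Rightarrow> real" and J' J'' L
  assumes J_deriv: "(J has_derivative (\<lambda>h. J' x \<bullet> h)) (at x)"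
    and J'_deriv: "(J' has_derivative blinfun_apply (J'' x)) (at x)"
    and lip: "norm (J'' x - J'' y) \<le> L * norm (x - y)"
    and L_pos: "L > 0"
begin

text \<open>Mean value inequality for \<open>v \<mapsto> J' v - J'' x v\<close>, whose derivative
  has norm at most \<open>L * r\<close> on the ball. The linearization stays at the centre, so that
  both points may vary.\<close>

lemma grad_linearization:
  assumes "y \<in> cball x r" "z \<in> cball x r"
  shows "norm (J' y - J' z - J'' x (y - z)) \<le> L * r * norm (y - z)"
proof -
  have "norm ((J' y - J'' x y) - (J' z - J'' x z)) \<le> (L * r) * norm (y - z)"
  proof (rule differentiable_bound[OF convex_cball _ _ assms])
    fix u assume u: "u \<in> cball x r"
    show "((\<lambda>v. J' v - J'' x v) has_derivative blinfun_apply (J'' u - J'' x)) (at u within cball x r)"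
      by (rule has_derivative_eq_rhs, rule has_derivative_diff,
          rule has_derivative_at_withinI[OF J'_deriv],
          rule bounded_linear_imp_has_derivative[OF blinfun.bounded_linear_right])
        (simp add: fun_eq_iff blinfun.diff_left)
    have "norm (J'' u - J'' x) \<le> L * r"
      by (rule order_trans[OF lip mult_left_mono]) (use u L_pos in \<open>auto simp: dist_norm norm_minus_commute\<close>)
    then show "onorm (blinfun_apply (J'' u - J'' x)) \<le> L * r"
      by (simp add: norm_blinfun.rep_eq)
  qed
  then show ?thesis
    by (simp add: blinfun.diff_right algebra_simps)
qed

text \<open>The left side compares \<open>J'' x u \<bullet> v\<close> with an expression symmetric
  in \<open>u\<close> and \<open>v\<close>; this is what yields symmetry of the Hessian.\<close>

lemma second_difference:
  assumes "t > 0"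
  shows "\<bar>J (x + t *\<^sub>R u + t *\<^sub>R v) - J (x + t *\<^sub>R u) - J (x + t *\<^sub>R v) + J x - t\<^sup>2 * (J'' x u \<bullet> v)\<bar>
    \<le> t ^ 3 * (L * (norm u + norm v) * norm u * norm v)"
proof -
  \<comment> \<open>The increment in direction \<open>u\<close> is already taken, so the mean value
    theorem in direction \<open>v\<close> leaves a gradient difference, to which
    \<open>grad_linearization\<close> applies.\<close>
  define g where "g s = J (x + t *\<^sub>R u + s *\<^sub>R v) - J (x + s *\<^sub>R v)" for s
  have "(g has_real_derivative (J' (x + t *\<^sub>R u + s *\<^sub>R v) - J' (x + s *\<^sub>R v)) \<bullet> v) (at s)" for s
    unfolding g_def has_field_derivative_def
    by (rule derivative_eq_intros has_derivative_compose[OF _ J_deriv] refl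
       | simp add: inner_simps fun_eq_iff algebra_simps)+
  then obtain s where s: "0 < s" "s < t"
    and eq: "g t - g 0 = t * ((J' (x + t *\<^sub>R u + s *\<^sub>R v) - J' (x + s *\<^sub>R v)) \<bullet> v)"
    using MVT2[OF \<open>t > 0\<close>, of g "\<lambda>s. (J' (x + t *\<^sub>R u + s *\<^sub>R v) - J' (x + s *\<^sub>R v)) \<bullet> v"] by auto
  define r where "r = t * (norm u + norm v)"
  have sv: "s * norm v \<le> t * norm v"
    using s by (intro mult_right_mono) auto
  have "norm (t *\<^sub>R u + s *\<^sub>R v) \<le> r" "norm (s *\<^sub>R v) \<le> r"
    using norm_triangle_ineq[of "t *\<^sub>R u" "s *\<^sub>R v"] sv s
    by (auto simp: r_def distrib_left intro: order_trans)
  then have "norm (J' (x + t *\<^sub>R u + s *\<^sub>R v) - J' (x + s *\<^sub>R v) - J'' x (t *\<^sub>R u)) \<le> L * r * norm (t *\<^sub>R u)"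
    using grad_linearization[of "x + t *\<^sub>R u + s *\<^sub>R v" x r "x + s *\<^sub>R v"]
    by (simp add: dist_norm norm_minus_commute algebra_simps)
  then have "\<bar>(J' (x + t *\<^sub>R u + s *\<^sub>R v) - J' (x + s *\<^sub>R v) - J'' x (t *\<^sub>R u)) \<bullet> v\<bar>
      \<le> L * r * norm (t *\<^sub>R u) * norm v"
    by (rule abs_inner_le)
  then have "t * \<bar>(J' (x + t *\<^sub>R u + s *\<^sub>R v) - J' (x + s *\<^sub>R v) - J'' x (t *\<^sub>R u)) \<bullet> v\<bar>
      \<le> t * (L * r * norm (t *\<^sub>R u) * norm v)"
    using \<open>t > 0\<close> by simp
  moreover have "J (x + t *\<^sub>R u + t *\<^sub>R v) - J (x + t *\<^sub>R u) - J (x + t *\<^sub>R v) + J x - t\<^sup>2 * (J'' x u \<bullet> v)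
    = t * ((J' (x + t *\<^sub>R u + s *\<^sub>R v) - J' (x + s *\<^sub>R v) - J'' x (t *\<^sub>R u)) \<bullet> v)"
    using eq by (simp add: g_def inner_simps blinfun.scaleR_right power2_eq_square algebra_simps)
  ultimately show ?thesis
    using \<open>t > 0\<close> by (simp only: abs_mult) (simp add: r_def power3_eq_cube algebra_simps)
qed

text \<open>Exchanging \<open>u\<close> and \<open>v\<close> leaves the second difference unchanged,
  so the two forms differ by at most a multiple of \<open>t\<close> for every \<open>t > 0\<close>.
  The contradiction uses one explicit small \<open>t\<close>.\<close>

lemma hessian_symmetric: "J'' x u \<bullet> v = J'' x v \<bullet> u"
proof (rule ccontr)
  define d where "d = \<bar>J'' x u \<bullet> v - J'' x v \<bullet> u\<bar>"
  define C where "C = L * (norm u + norm v) * norm u * norm v"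
  assume "\<not> ?thesis"
  then have "d > 0" by (simp add: d_def)
  have "C \<ge> 0" using L_pos by (simp add: C_def)
  have bound: "d \<le> 2 * t * C" if "t > 0" for t
  proof -
    have "t\<^sup>2 * (J'' x u \<bullet> v) - t\<^sup>2 * (J'' x v \<bullet> u) \<le> 2 * (t ^ 3 * C)"
      "t\<^sup>2 * (J'' x v \<bullet> u) - t\<^sup>2 * (J'' x u \<bullet> v) \<le> 2 * (t ^ 3 * C)"
      using second_difference[OF that, of x u v] second_difference[OF that, of x v u]
      by (simp_all add: C_def algebra_simps abs_le_iff)
    then have "t\<^sup>2 * d \<le> t\<^sup>2 * (2 * t * C)"
      by (simp add: d_def abs_if power2_eq_square power3_eq_cube algebra_simps)
    then show ?thesis
      using that by simp
  qed
  have "2 * (d / (4 * (C + 1))) * C < d"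
    using \<open>d > 0\<close> \<open>C \<ge> 0\<close> by (simp add: field_simps add_pos_nonneg)
  then show False
    using bound[of "d / (4 * (C + 1))"] \<open>d > 0\<close> \<open>C \<ge> 0\<close> by simp
qed

end

section \<open>Taylor estimates at the minimizer\<close>

text \<open>The two smallness assumptions stand in for \<open>L * norm w < t0\<close>, from which
  \<open>C0_hat_less\<close> derives them.\<close>

locale source_condition = lipschitz_hessian J J' J'' L
  for J :: "'a::{real_inner,complete_space} \<Rightarrow> real" and J' J'' L +
  fixes xstar \<xi> w :: 'a and C0 :: real
  assumes minimal: "J xstar \<le> J x"
    and source: "xstar - \<xi> = J'' xstar w"
    and w_small: "L * norm w < 1"
    and C0_def: "C0 = C0_hat L w"
    and C0_small: "L * C0 < 1"
begin

lemma grad_xstar: "J' xstar = 0"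
proof -
  have "(\<lambda>h. J' xstar \<bullet> h) = (\<lambda>h. 0)"
    by (rule has_derivative_local_min[OF J_deriv]) (simp add: minimal)
  then have "J' xstar \<bullet> J' xstar = 0" by metis
  then show ?thesis by simp
qed

text \<open>Integrating the Lipschitz bound along the segment gains the factor 1/2 over
  \<open>grad_linearization\<close>; this sharp constant enters \<open>C0\<close>.\<close>

lemma grad_taylor: "norm (J' (xstar + h) - J'' xstar h) \<le> L / 2 * (norm h)\<^sup>2"
proof -
  define g where "g t = J' (xstar + t *\<^sub>R h) - t *\<^sub>R J'' xstar h" for t
  have g: "(g has_vector_derivative (J'' (xstar + t *\<^sub>R h) - J'' xstar) h) (at t)" for t
    unfolding g_def has_vector_derivative_def
    by (rule derivative_eq_intros has_derivative_compose[OF _ J'_deriv] refl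
       | simp add: blinfun.diff_left blinfun.scaleR_right fun_eq_iff algebra_simps)+
  have "norm (g 1 - g 0) \<le> L / 2 * (norm h)\<^sup>2 * 1\<^sup>2 - L / 2 * (norm h)\<^sup>2 * 0\<^sup>2"
  proof (rule differentiable_bound_general[OF zero_less_one _ _ g])
    show "continuous_on {0..1} g"
      by (rule continuous_on_vector_derivative[OF has_vector_derivative_at_within[OF g]])
    fix t :: real assume "0 < t" "t < 1"
    show "((\<lambda>t. L / 2 * (norm h)\<^sup>2 * t\<^sup>2) has_vector_derivative L * t * (norm h)\<^sup>2) (at t)"
      by (auto intro!: derivative_eq_intros simp flip: has_real_derivative_iff_has_vector_derivative)
    have "norm ((J'' (xstar + t *\<^sub>R h) - J'' xstar) h) \<le> norm (J'' (xstar + t *\<^sub>R h) - J'' xstar) * norm h"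
      by (rule norm_blinfun)
    also have "\<dots> \<le> (L * norm (t *\<^sub>R h)) * norm h"
      using lip[of "xstar + t *\<^sub>R h" xstar] by (intro mult_right_mono) auto
    finally show "norm ((J'' (xstar + t *\<^sub>R h) - J'' xstar) h) \<le> L * t * (norm h)\<^sup>2"
      using \<open>0 < t\<close> by (simp add: power2_eq_square algebra_simps)
  qed (intro continuous_intros)
  then show ?thesis
    by (simp add: g_def grad_xstar)
qed

text \<open>Third order Taylor remainder at \<open>xstar\<close>; the linear term is absent because
  \<open>J' xstar = 0\<close>.\<close>

definition remainder :: "'a \<Rightarrow> real" where
  "remainder h = J (xstar + h) - J xstar - J'' xstar h \<bullet> h / 2"

text \<open>The bound on the derivative along the segment from \<open>e\<close> to
  \<open>e + k\<close> integrates to a difference of cubes. Bounding the two remainders separately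
  would leave a term in \<open>norm e ^ 3\<close>.\<close>

lemma remainder_diff_le:
  "\<bar>remainder (e + k) - remainder e\<bar> \<le> L / 6 * ((norm e + norm k) ^ 3 - norm e ^ 3)"
proof -
  define g where "g t = remainder (e + t *\<^sub>R k)" for t
  have g: "(g has_vector_derivative (J' (xstar + (e + t *\<^sub>R k)) - J'' xstar (e + t *\<^sub>R k)) \<bullet> k) (at t)" for t
    unfolding g_def remainder_def has_vector_derivative_def
    by (rule derivative_eq_intros has_derivative_compose[OF _ J_deriv] refl
       | simp add: blinfun.add_right blinfun.scaleR_right fun_eq_iff inner_simps
           hessian_symmetric[of _ k e] algebra_simps)+
  define \<phi> where "\<phi> t = L / 6 * (norm e + t * norm k) ^ 3" for t
  have "norm (g 1 - g 0) \<le> \<phi> 1 - \<phi> 0"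
  proof (rule differentiable_bound_general[OF zero_less_one _ _ g])
    show "continuous_on {0..1} g"
      by (rule continuous_on_vector_derivative[OF has_vector_derivative_at_within[OF g]])
    show "continuous_on {0..1} \<phi>"
      unfolding \<phi>_def by (intro continuous_intros)
    fix t :: real assume "0 < t" "t < 1"
    show "(\<phi> has_vector_derivative L / 2 * (norm e + t * norm k)\<^sup>2 * norm k) (at t)"
      unfolding \<phi>_def
      by (auto intro!: derivative_eq_intros simp: power2_eq_square simp flip: has_real_derivative_iff_has_vector_derivative)
    let ?h = "e + t *\<^sub>R k"
    have "norm ?h \<le> norm e + t * norm k"
      using norm_triangle_ineq[of e "t *\<^sub>R k"] \<open>0 < t\<close> by simp
    then have "L / 2 * (norm ?h)\<^sup>2 \<le> L / 2 * (norm e + t * norm k)\<^sup>2"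
      using L_pos by (intro mult_left_mono power_mono) auto
    with grad_taylor[of ?h]
    have "norm (J' (xstar + ?h) - J'' xstar ?h) \<le> L / 2 * (norm e + t * norm k)\<^sup>2"
      by linarith
    then show "norm ((J' (xstar + ?h) - J'' xstar ?h) \<bullet> k) \<le> L / 2 * (norm e + t * norm k)\<^sup>2 * norm k"
      unfolding real_norm_def by (rule abs_inner_le)
  qed
  then show ?thesis
    by (simp add: g_def \<phi>_def algebra_simps)
qed

lemma remainder_le: "\<bar>remainder k\<bar> \<le> L / 6 * norm k ^ 3"
  using remainder_diff_le[of 0 k] by (simp add: remainder_def)

text \<open>Second order necessary condition: in a direction of negative curvature the quadratic
  decrease beats the cubic remainder for small \<open>t\<close>, against minimality.\<close>

lemma hessian_xstar_nonneg: "0 \<le> J'' xstar h \<bullet> h"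
proof (rule ccontr)
  define q where "q = - (J'' xstar h \<bullet> h)"
  define C where "C = L / 6 * norm h ^ 3"
  assume "\<not> ?thesis"
  then have "q > 0" by (simp add: q_def)
  have "C \<ge> 0" using L_pos by (simp add: C_def)
  have bound: "q \<le> 2 * t * C" if "t > 0" for t
  proof -
    have "t\<^sup>2 * q \<le> t\<^sup>2 * (2 * t * C)"
      using abs_le_D1[OF remainder_le[of "t *\<^sub>R h"]] minimal[of "xstar + t *\<^sub>R h"] that
      by (simp add: remainder_def q_def C_def power_mult_distrib blinfun.scaleR_right
          power2_eq_square power3_eq_cube algebra_simps)
    then show ?thesis
      using that by simp
  qed
  have "2 * (q / (4 * (C + 1))) * C < q"
    using \<open>q > 0\<close> \<open>C \<ge> 0\<close> by (simp add: field_simps add_pos_nonneg)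
  then show False
    using bound[of "q / (4 * (C + 1))"] \<open>q > 0\<close> \<open>C \<ge> 0\<close> by simp
qed

section \<open>The Tikhonov functional and its stationary points\<close>

definition tikhonov :: "real \<Rightarrow> 'a \<Rightarrow> real" where
  "tikhonov \<alpha> x = J x + \<alpha> * (norm (x - \<xi>))\<^sup>2"

definition tikhonov_grad :: "real \<Rightarrow> 'a \<Rightarrow> 'a" where
  "tikhonov_grad \<alpha> x = J' x + (2 * \<alpha>) *\<^sub>R (x - \<xi>)"

lemma tikhonov_deriv: "(tikhonov \<alpha> has_derivative (\<lambda>h. tikhonov_grad \<alpha> x \<bullet> h)) (at x)"
  unfolding tikhonov_def[abs_def] tikhonov_grad_def power2_norm_eq_inner
  by (rule derivative_eq_intros J_deriv refl | simp add: inner_simps inner_commute fun_eq_iff algebra_simps)+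

text \<open>With \<open>e = u - xstar\<close>, stationarity reads to first order
  \<open>J'' xstar (e + 2 \<alpha> w) = 0\<close>, which suggests the comparison point
  \<open>xstar - 2 \<alpha> w\<close>. Only values are compared, so the bound is available before
  the minimizer is known to be interior.\<close>

lemma tikhonov_error_bound:
  assumes "\<alpha> > 0" and le: "tikhonov \<alpha> u \<le> tikhonov \<alpha> (xstar - (2 * \<alpha>) *\<^sub>R w)"
  shows "norm (u - xstar) \<le> C0 * \<alpha>"
proof -
  define e k where "e = u - xstar" and "k = (2 * \<alpha>) *\<^sub>R w"
  define E W a q where "E = norm e" and "W = norm w" and "a = 1 - L * W"
    and "q = 4 * W\<^sup>2 + 8 / 3 * L * W ^ 3"
  define Q where "Q = J'' xstar w \<bullet> w"
  have u: "u = xstar + e" by (simp add: e_def)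
  have xi: "u - \<xi> = e + J'' xstar w" "xstar - k - \<xi> = J'' xstar w - k"
    using source by (simp_all add: u algebra_simps)
  have Ju: "J u = J xstar + remainder e + J'' xstar e \<bullet> e / 2"
    by (simp add: remainder_def u)
  have Jv: "J (xstar - k) = J xstar + remainder (- k) + 2 * \<alpha>\<^sup>2 * Q"
    by (simp add: remainder_def k_def Q_def blinfun.minus_right blinfun.scaleR_right power2_eq_square)
  \<comment> \<open>Bounding the quadratic form at \<open>e + k\<close> through minimality, instead of by \<open>0\<close>, leaves only
    the difference of two remainders, in which the cubic term in \<open>norm e\<close> cancels.\<close>
  have "0 \<le> remainder (e + k) + J'' xstar (e + k) \<bullet> (e + k) / 2"
    using minimal[of "xstar + (e + k)"] by (simp add: remainder_def)
  also have "J'' xstar (e + k) \<bullet> (e + k) = J'' xstar e \<bullet> e + 4 * \<alpha> * (J'' xstar w \<bullet> e) + 4 * \<alpha>\<^sup>2 * Q"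
    using hessian_symmetric[of xstar e w]
    by (simp add: k_def Q_def blinfun.add_right blinfun.scaleR_right inner_simps power2_eq_square algebra_simps)
  finally have 1: "0 \<le> remainder (e + k) + J'' xstar e \<bullet> e / 2 + 2 * \<alpha> * (J'' xstar w \<bullet> e) + 2 * \<alpha>\<^sup>2 * Q"
    by argo
  have nu: "(norm (u - \<xi>))\<^sup>2 = E\<^sup>2 + 2 * (J'' xstar w \<bullet> e) + (norm (J'' xstar w))\<^sup>2"
    unfolding xi E_def power2_norm_eq_inner by (simp add: inner_simps inner_commute)
  have nv: "(norm (xstar - k - \<xi>))\<^sup>2 = (norm (J'' xstar w))\<^sup>2 - 4 * \<alpha> * Q + 4 * \<alpha>\<^sup>2 * W\<^sup>2"
    unfolding xi Q_def W_def power2_norm_eq_inner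
    by (simp add: k_def inner_simps inner_commute power2_eq_square algebra_simps)
  have "J u + \<alpha> * (norm (u - \<xi>))\<^sup>2 \<le> J (xstar - k) + \<alpha> * (norm (xstar - k - \<xi>))\<^sup>2"
    using le by (simp add: tikhonov_def k_def)
  then have "\<alpha> * E\<^sup>2 \<le> (remainder (e + k) - remainder e) + remainder (- k) + 4 * \<alpha> ^ 3 * W\<^sup>2"
    using 1 unfolding Ju Jv nu nv by (simp add: power2_eq_square power3_eq_cube algebra_simps)
  also have "remainder (e + k) - remainder e \<le> L / 6 * ((E + 2 * \<alpha> * W) ^ 3 - E ^ 3)"
    using abs_le_D1[OF remainder_diff_le[of e k]] \<open>\<alpha> > 0\<close> by (simp add: E_def W_def k_def)
  also have "remainder (- k) \<le> L / 6 * (2 * \<alpha> * W) ^ 3"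
    using abs_le_D1[OF remainder_le[of "- k"]] \<open>\<alpha> > 0\<close> by (simp add: W_def k_def)
  \<comment> \<open>Expanding the cubes gives \<open>L W \<alpha> E^2\<close>, absorbed on the left
    and turning 1 into \<open>a\<close>; the pure \<open>\<alpha>^3\<close> terms of both remainders
    add up to \<open>8/3 L W^3\<close>.\<close>
  finally have "\<alpha> * (a * E\<^sup>2) \<le> \<alpha> * (2 * L * W\<^sup>2 * \<alpha> * E + q * \<alpha>\<^sup>2)"
    by (simp add: a_def q_def power2_eq_square power3_eq_cube algebra_simps)
  then have *: "a * E\<^sup>2 \<le> 2 * L * W\<^sup>2 * \<alpha> * E + q * \<alpha>\<^sup>2"
    using \<open>\<alpha> > 0\<close> by simp
  have "a > 0" using w_small by (simp add: a_def W_def)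
  \<comment> \<open>Completing the square solves the quadratic inequality for \<open>E\<close>; its
    larger root is \<open>C0 * \<alpha>\<close>.\<close>
  have "(a * E - L * W\<^sup>2 * \<alpha>)\<^sup>2 = a * (a * E\<^sup>2 - 2 * L * W\<^sup>2 * \<alpha> * E) + L\<^sup>2 * W ^ 4 * \<alpha>\<^sup>2"
    by (simp add: power2_eq_square power4_eq_xxxx algebra_simps)
  also have "\<dots> \<le> a * (q * \<alpha>\<^sup>2) + L\<^sup>2 * W ^ 4 * \<alpha>\<^sup>2"
    using * \<open>a > 0\<close> by (intro add_right_mono mult_left_mono) auto
  also have "\<dots> = (L\<^sup>2 * W ^ 4 + a * q) * \<alpha>\<^sup>2"
    by (simp add: algebra_simps)
  finally have "a * E - L * W\<^sup>2 * \<alpha> \<le> sqrt (L\<^sup>2 * W ^ 4 + a * q) * \<alpha>"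
    using \<open>\<alpha> > 0\<close> by (metis real_le_rsqrt real_sqrt_mult real_sqrt_abs abs_of_pos)
  then have "E \<le> 1 / a * (L * W\<^sup>2 + sqrt (L\<^sup>2 * W ^ 4 + a * q)) * \<alpha>"
    using \<open>a > 0\<close> by (simp add: field_simps)
  then show ?thesis
    unfolding C0_def C0_hat_def E_def e_def W_def[symmetric] a_def q_def .
qed

text \<open>Places the comparison point \<open>xstar - 2 \<alpha> w\<close> within distance
  \<open>C0 * \<alpha>\<close> of \<open>xstar\<close>. After squaring, the inequality holds with
  the explicit slack \<open>32/3 a L W^3\<close>.\<close>

lemma two_norm_w_le_C0: "2 * norm w \<le> C0"
proof -
  define W a where "W = norm w" and "a = 1 - L * W"
  have "W \<ge> 0" "a > 0" using w_small by (simp_all add: W_def a_def)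
  have "(2 * W * a - L * W\<^sup>2)\<^sup>2 \<le> L\<^sup>2 * W ^ 4 + a * (4 * W\<^sup>2 + 8 / 3 * L * W ^ 3)"
  proof -
    have "L\<^sup>2 * W ^ 4 + a * (4 * W\<^sup>2 + 8 / 3 * L * W ^ 3) - (2 * W * a - L * W\<^sup>2)\<^sup>2
      = a * (32 / 3 * L * W ^ 3)"
      by (simp add: a_def power2_eq_square power3_eq_cube power4_eq_xxxx field_simps)
    also have "\<dots> \<ge> 0" using \<open>W \<ge> 0\<close> \<open>a > 0\<close> L_pos by simp
    finally show ?thesis by linarith
  qed
  then have "2 * W * a - L * W\<^sup>2 \<le> sqrt (L\<^sup>2 * W ^ 4 + a * (4 * W\<^sup>2 + 8 / 3 * L * W ^ 3))"
    by (rule real_le_rsqrt)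
  then have "2 * W \<le> 1 / a * (L * W\<^sup>2 + sqrt (L\<^sup>2 * W ^ 4 + a * (4 * W\<^sup>2 + 8 / 3 * L * W ^ 3)))"
    using \<open>a > 0\<close> by (simp add: field_simps)
  then show ?thesis
    unfolding C0_def C0_hat_def W_def[symmetric] a_def .
qed

lemma C0_nonneg: "0 \<le> C0"
  using two_norm_w_le_C0 norm_ge_zero[of w] by linarith

text \<open>The Hessian form is retained instead of being bounded below by 0, because
  \<open>reg_point_diff\<close> uses it to absorb the source term.\<close>

lemma grad_monotone:
  assumes "x \<in> cball xstar r" "y \<in> cball xstar r"
  shows "(J' y - J' x) \<bullet> (y - x) \<ge> J'' xstar (y - x) \<bullet> (y - x) - L * r * (norm (y - x))\<^sup>2"
proof -
  have "\<bar>(J' y - J' x - J'' xstar (y - x)) \<bullet> (y - x)\<bar> \<le> L * r * norm (y - x) * norm (y - x)"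
    by (rule abs_inner_le[OF grad_linearization[OF assms(2,1)]])
  then show ?thesis
    by (simp add: inner_diff_left power2_eq_square)
qed

lemma exists_stationary_point:
  assumes "\<alpha> > 0"
  shows "\<exists>u. norm (u - xstar) \<le> C0 * \<alpha> \<and> tikhonov_grad \<alpha> u = 0"
proof -
  \<comment> \<open>At this radius the possible nonconvexity \<open>L * r\<close> of
    \<open>J\<close> costs \<open>\<alpha>\<close>, half of the \<open>2 * \<alpha>\<close> supplied
    by the penalty.\<close>
  define r where "r = \<alpha> / L"
  define S where "S = cball xstar r"
  have "r > 0" "L * r = \<alpha>" using \<open>\<alpha> > 0\<close> L_pos by (auto simp: r_def)
  have "C0 * \<alpha> < r"
    using C0_small \<open>\<alpha> > 0\<close> L_pos by (simp add: r_def field_simps)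
  have mono: "(tikhonov_grad \<alpha> y - tikhonov_grad \<alpha> x) \<bullet> (y - x) \<ge> \<alpha> * (norm (y - x))\<^sup>2"
    if "x \<in> S" "y \<in> S" for x y
  proof -
    have "(tikhonov_grad \<alpha> y - tikhonov_grad \<alpha> x) \<bullet> (y - x)
        = (J' y - J' x) \<bullet> (y - x) + 2 * \<alpha> * (norm (y - x))\<^sup>2"
      by (simp add: tikhonov_grad_def power2_norm_eq_inner inner_simps algebra_simps)
    then show ?thesis
      using grad_monotone[of x r y] hessian_xstar_nonneg[of "y - x"] that \<open>L * r = \<alpha>\<close>
      by (simp add: S_def)
  qed
  have convS: "convex S" by (simp add: S_def)
  have mid_in: "midpoint x y \<in> S" if "x \<in> S" "y \<in> S" for x y
    using convexD[OF convS that, of "1/2" "1/2"] by (simp add: midpoint_def scaleR_add_right)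
  have "\<exists>u\<in>S. \<forall>y\<in>S. tikhonov \<alpha> u \<le> tikhonov \<alpha> y"
  proof (rule exists_minimizer_of_midpoint_convex[OF _ _ _ _ _ mid_in])
    show "closed S" "S \<noteq> {}" using \<open>r > 0\<close> by (auto simp: S_def)
    show "continuous_on S (tikhonov \<alpha>)"
      by (rule has_derivative_continuous_on[OF has_derivative_at_withinI[OF tikhonov_deriv]])
    show "J xstar \<le> tikhonov \<alpha> x" for x
      using minimal[of x] \<open>\<alpha> > 0\<close> by (simp add: tikhonov_def add_increasing2)
    show "\<alpha> / 8 > 0" using \<open>\<alpha> > 0\<close> by simp
    fix x y assume xy: "x \<in> S" "y \<in> S"
    let ?z = "midpoint x y"
    note lower = strong_monotone_imp_lower_quadratic[OF convS mid_in[OF xy] _ tikhonov_deriv mono]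
    have d: "x - ?z = (1 / 2) *\<^sub>R (x - y)" "y - ?z = - ((1 / 2) *\<^sub>R (x - y))"
      by (simp_all add: midpoint_def algebra_simps flip: scaleR_add_left)
    \<comment> \<open>The gradient terms at the midpoint cancel in the average; each half segment
      contributes \<open>\<alpha> / 2\<close> times a quarter of the squared distance, hence
      \<open>\<alpha> / 8\<close>.\<close>
    show "tikhonov \<alpha> ?z \<le> (tikhonov \<alpha> x + tikhonov \<alpha> y) / 2 - \<alpha> / 8 * (norm (x - y))\<^sup>2"
      using lower[OF xy(1)] lower[OF xy(2)] unfolding d
      by (simp add: power_mult_distrib power_divide) argo
  qed
  then obtain u where u: "u \<in> S" and min: "\<And>y. y \<in> S \<Longrightarrow> tikhonov \<alpha> u \<le> tikhonov \<alpha> y"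
    by blast
  have "2 * norm w * \<alpha> \<le> C0 * \<alpha>"
    using two_norm_w_le_C0 \<open>\<alpha> > 0\<close> by simp
  moreover have "dist xstar (xstar - (2 * \<alpha>) *\<^sub>R w) = 2 * norm w * \<alpha>"
    using \<open>\<alpha> > 0\<close> by (simp add: dist_norm)
  ultimately have "xstar - (2 * \<alpha>) *\<^sub>R w \<in> S"
    using \<open>C0 * \<alpha> < r\<close> unfolding S_def mem_cball by linarith
  then have bound: "norm (u - xstar) \<le> C0 * \<alpha>"
    by (intro tikhonov_error_bound \<open>\<alpha> > 0\<close> min)
  \<comment> \<open>\<open>L * C0 < 1\<close> puts the constrained minimizer inside the open ball,
    so it is a local minimizer and its gradient vanishes.\<close>
  then have "u \<in> ball xstar r"
    using \<open>C0 * \<alpha> < r\<close> by (simp add: dist_norm norm_minus_commute)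
  then have "eventually (\<lambda>y. y \<in> ball xstar r) (at u)"
    by (rule eventually_at_in_open'[OF open_ball])
  then have "eventually (\<lambda>y. tikhonov \<alpha> u \<le> tikhonov \<alpha> y) (at u)"
    by eventually_elim (use min in \<open>auto simp: S_def\<close>)
  then have "(\<lambda>h. tikhonov_grad \<alpha> u \<bullet> h) = (\<lambda>h. 0)"
    by (rule has_derivative_local_min[OF tikhonov_deriv])
  then have "tikhonov_grad \<alpha> u \<bullet> tikhonov_grad \<alpha> u = 0" by metis
  then show ?thesis using bound by auto
qed

section \<open>The regularized points and their dependence on the parameter\<close>

definition reg_point :: "real \<Rightarrow> 'a" where
  "reg_point \<alpha> = (SOME u. norm (u - xstar) \<le> C0 * \<alpha> \<and> tikhonov_grad \<alpha> u = 0)"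

lemma reg_point:
  assumes "\<alpha> > 0"
  shows "norm (reg_point \<alpha> - xstar) \<le> C0 * \<alpha>" "tikhonov_grad \<alpha> (reg_point \<alpha>) = 0"
  using someI_ex[OF exists_stationary_point[OF assms]] by (auto simp: reg_point_def)

text \<open>The constant that results from the two absorption steps in
  \<open>reg_point_diff\<close>.\<close>

definition drift :: real where
  "drift = sqrt (2 * (J'' xstar w \<bullet> w) + 4 * C0\<^sup>2)"

lemma drift_nonneg: "drift \<ge> 0"
  using hessian_xstar_nonneg[of w] by (simp add: drift_def)

text \<open>The difference of the two stationarity equations is tested with \<open>h\<close>. The
  source part of \<open>xb - \<xi>\<close> is absorbed by the Hessian form and the rest is of size
  \<open>C0 * \<alpha>\<close>; this gives a rate with \<open>sqrt \<alpha>\<close> in place of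
  \<open>\<alpha>\<close>.\<close>

lemma reg_point_diff:
  assumes "0 < \<beta>" "\<beta> \<le> \<alpha>" "\<alpha> \<le> 1"
  shows "sqrt \<alpha> * norm (reg_point \<alpha> - reg_point \<beta>) \<le> drift * (\<alpha> - \<beta>)"
proof -
  define xa xb h \<epsilon> q H where "xa = reg_point \<alpha>" and "xb = reg_point \<beta>" and "h = xb - xa"
    and "\<epsilon> = \<alpha> - \<beta>" and "q = J'' xstar w \<bullet> w" and "H = norm h"
  have "\<alpha> > 0" "\<epsilon> \<ge> 0" using assms by (auto simp: \<epsilon>_def)
  have a: "norm (xa - xstar) \<le> C0 * \<alpha>" and b: "norm (xb - xstar) \<le> C0 * \<beta>"
    using reg_point(1) \<open>\<alpha> > 0\<close> \<open>0 < \<beta>\<close> by (auto simp: xa_def xb_def)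
  have "C0 * \<beta> \<le> C0 * \<alpha>" using C0_nonneg assms by (simp add: mult_left_mono)
  with a b have mem: "xa \<in> cball xstar (C0 * \<alpha>)" "xb \<in> cball xstar (C0 * \<alpha>)"
    by (auto simp: dist_norm norm_minus_commute)
  have J'a: "J' xa = - ((2 * \<alpha>) *\<^sub>R (xa - \<xi>))" and J'b: "J' xb = - ((2 * \<beta>) *\<^sub>R (xb - \<xi>))"
    using reg_point(2)[OF \<open>\<alpha> > 0\<close>] reg_point(2)[OF \<open>0 < \<beta>\<close>]
    by (simp_all add: tikhonov_grad_def xa_def xb_def eq_neg_iff_add_eq_0)
  have "J' xb - J' xa = (2 * \<epsilon>) *\<^sub>R (xb - \<xi>) - (2 * \<alpha>) *\<^sub>R h"
    by (simp add: J'a J'b \<epsilon>_def h_def algebra_simps)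
  then have "(J' xb - J' xa) \<bullet> h = 2 * \<epsilon> * ((xb - \<xi>) \<bullet> h) - 2 * \<alpha> * H\<^sup>2"
    by (simp add: H_def power2_norm_eq_inner inner_diff_left)
  moreover have "(J' xb - J' xa) \<bullet> h \<ge> J'' xstar h \<bullet> h - L * (C0 * \<alpha>) * H\<^sup>2"
    using grad_monotone[OF mem] by (simp add: h_def H_def)
  moreover have "L * (C0 * \<alpha>) * H\<^sup>2 \<le> \<alpha> * H\<^sup>2"
    using mult_right_mono[of "L * C0" 1 "\<alpha> * H\<^sup>2"] C0_small \<open>\<alpha> > 0\<close> by (simp add: ac_simps)
  ultimately have 1: "J'' xstar h \<bullet> h + \<alpha> * H\<^sup>2 \<le> 2 * \<epsilon> * ((xb - \<xi>) \<bullet> h)"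
    by linarith
  have "xb - \<xi> = (xb - xstar) + J'' xstar w"
    unfolding source[symmetric] by simp
  then have 2: "(xb - \<xi>) \<bullet> h = (xb - xstar) \<bullet> h + J'' xstar w \<bullet> h"
    by (simp only: inner_add_left)
  have "(xb - xstar) \<bullet> h \<le> norm (xb - xstar) * H"
    unfolding H_def by (rule norm_cauchy_schwarz)
  also have "\<dots> \<le> C0 * \<alpha> * H"
    using b \<open>C0 * \<beta> \<le> C0 * \<alpha>\<close> by (intro mult_right_mono) (auto simp: H_def)
  finally have 3: "2 * \<epsilon> * ((xb - xstar) \<bullet> h) \<le> 2 * \<epsilon> * (C0 * \<alpha> * H)"
    using \<open>\<epsilon> \<ge> 0\<close> by (intro mult_left_mono) auto
  \<comment> \<open>Young's inequality in the semi-inner product of \<open>J'' xstar\<close>: the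
    mixed term costs the form at \<open>h\<close>, available from step 1, plus
    \<open>\<epsilon>^2 q\<close>.\<close>
  have "0 \<le> J'' xstar (h - \<epsilon> *\<^sub>R w) \<bullet> (h - \<epsilon> *\<^sub>R w)"
    by (rule hessian_xstar_nonneg)
  also have "\<dots> = J'' xstar h \<bullet> h - 2 * \<epsilon> * (J'' xstar w \<bullet> h) + \<epsilon>\<^sup>2 * q"
    using hessian_symmetric[of xstar h w]
    by (simp add: q_def blinfun.diff_right blinfun.scaleR_right inner_simps power2_eq_square algebra_simps)
  finally have 4: "\<alpha> * H\<^sup>2 \<le> \<epsilon>\<^sup>2 * q + 2 * \<epsilon> * (C0 * \<alpha> * H)"
    using 1 3 unfolding 2 by (simp add: algebra_simps)
  \<comment> \<open>This square absorbs the term linear in \<open>H\<close> into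
    \<open>\<alpha> * H^2\<close>.\<close>
  have "0 \<le> \<alpha> * (H - 2 * \<epsilon> * C0)\<^sup>2"
    using \<open>\<alpha> > 0\<close> by simp
  also have "\<dots> = \<alpha> * H\<^sup>2 - 4 * \<epsilon> * (C0 * \<alpha> * H) + 4 * \<epsilon>\<^sup>2 * C0\<^sup>2 * \<alpha>"
    by (simp add: power2_eq_square algebra_simps)
  also have "4 * \<epsilon>\<^sup>2 * C0\<^sup>2 * \<alpha> \<le> 4 * \<epsilon>\<^sup>2 * C0\<^sup>2"
    using \<open>\<alpha> \<le> 1\<close> by (intro mult_left_le) auto
  finally have "\<alpha> * H\<^sup>2 \<le> \<epsilon>\<^sup>2 * (2 * q + 4 * C0\<^sup>2)"
    using 4 by (simp add: algebra_simps)
  then have "sqrt (\<alpha> * H\<^sup>2) \<le> sqrt (\<epsilon>\<^sup>2 * (2 * q + 4 * C0\<^sup>2))"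
    by (rule real_sqrt_le_mono)
  then show ?thesis
    using \<open>\<epsilon> \<ge> 0\<close>
    by (simp add: real_sqrt_mult drift_def q_def H_def h_def xa_def xb_def \<epsilon>_def norm_minus_commute ac_simps)
qed

section \<open>Contraction of one exact gradient step\<close>

text \<open>The derivative of the step map is symmetric, so its quadratic form controls its norm.
  The step size condition keeps the form nonnegative; \<open>J'' xstar \<ge> 0\<close> and the
  Lipschitz bound keep it below the contraction factor.\<close>

lemma gradient_step_contraction:
  assumes "\<alpha> > 0" "\<tau> \<ge> 0" and \<tau>: "\<tau> * (norm (J'' xstar) + (L * \<theta> + 2) * \<alpha>) \<le> 1"
    and xy: "x \<in> cball xstar (\<theta> * \<alpha>)" "y \<in> cball xstar (\<theta> * \<alpha>)"
  shows "norm ((x - \<tau> *\<^sub>R tikhonov_grad \<alpha> x) - (y - \<tau> *\<^sub>R tikhonov_grad \<alpha> y))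
    \<le> (1 - \<tau> * (2 - L * \<theta>) * \<alpha>) * norm (x - y)"
proof (cases "x = y")
  case False
  show ?thesis
  proof (rule differentiable_bound[OF convex_cball _ _ xy])
    fix u assume u: "u \<in> cball xstar (\<theta> * \<alpha>)"
    define S where "S h = h - \<tau> *\<^sub>R (J'' u h + (2 * \<alpha>) *\<^sub>R h)" for h
    show "((\<lambda>x. x - \<tau> *\<^sub>R tikhonov_grad \<alpha> x) has_derivative S) (at u within cball xstar (\<theta> * \<alpha>))"
      unfolding tikhonov_grad_def S_def
      by (rule derivative_eq_intros has_derivative_at_withinI[OF J'_deriv] refl | simp)+
    have S: "norm (S h) \<le> (1 - \<tau> * (2 - L * \<theta>) * \<alpha>) * norm h" for h
    proof (rule norm_le_if_symmetric_form_le)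
      show "linear S"
        by (rule linearI) (simp_all add: S_def blinfun.add_right blinfun.scaleR_right algebra_simps)
      show "S v \<bullet> z = S z \<bullet> v" for v z
        using hessian_symmetric[of u v z] by (simp add: S_def inner_simps inner_commute algebra_simps)
      fix h
      have "norm (J'' u - J'' xstar) \<le> L * (\<theta> * \<alpha>)"
        by (rule order_trans[OF lip mult_left_mono]) (use u L_pos in \<open>auto simp: dist_norm norm_minus_commute\<close>)
      then have "norm ((J'' u - J'' xstar) h) \<le> L * (\<theta> * \<alpha>) * norm h"
        by (meson norm_blinfun mult_right_mono norm_ge_zero order_trans)
      then have "\<bar>(J'' u - J'' xstar) h \<bullet> h\<bar> \<le> L * (\<theta> * \<alpha>) * norm h * norm h"
        by (rule abs_inner_le)
      then have 1: "\<bar>J'' u h \<bullet> h - J'' xstar h \<bullet> h\<bar> \<le> L * \<theta> * \<alpha> * (norm h)\<^sup>2"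
        by (simp add: blinfun.diff_left inner_diff_left power2_eq_square ac_simps)
      have "\<bar>J'' xstar h \<bullet> h\<bar> \<le> norm (J'' xstar) * norm h * norm h"
        by (rule abs_inner_le[OF norm_blinfun])
      then have 2: "J'' xstar h \<bullet> h \<le> norm (J'' xstar) * (norm h)\<^sup>2"
        by (simp add: power2_eq_square)
      define Q where "Q = J'' u h \<bullet> h + 2 * \<alpha> * (norm h)\<^sup>2"
      have "Q \<le> (norm (J'' xstar) + (L * \<theta> + 2) * \<alpha>) * (norm h)\<^sup>2"
        using 1 2 by (simp add: Q_def algebra_simps)
      then have "\<tau> * Q \<le> \<tau> * ((norm (J'' xstar) + (L * \<theta> + 2) * \<alpha>) * (norm h)\<^sup>2)"
        using \<open>\<tau> \<ge> 0\<close> by (rule mult_left_mono)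
      also have "\<dots> \<le> 1 * (norm h)\<^sup>2"
        unfolding mult.assoc[symmetric] using \<tau> by (rule mult_right_mono) simp
      finally have upper: "\<tau> * Q \<le> (norm h)\<^sup>2" by simp
      have "(2 - L * \<theta>) * \<alpha> * (norm h)\<^sup>2 \<le> Q"
        using 1 hessian_xstar_nonneg[of h] by (simp add: Q_def algebra_simps)
      then have lower: "\<tau> * ((2 - L * \<theta>) * \<alpha> * (norm h)\<^sup>2) \<le> \<tau> * Q"
        using \<open>\<tau> \<ge> 0\<close> by (rule mult_left_mono)
      have "S h \<bullet> h = (norm h)\<^sup>2 - \<tau> * Q"
        by (simp add: S_def Q_def power2_norm_eq_inner inner_simps)
      then show "\<bar>S h \<bullet> h\<bar> \<le> (1 - \<tau> * (2 - L * \<theta>) * \<alpha>) * (norm h)\<^sup>2"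
        using upper lower by (simp add: algebra_simps)
    qed
    \<comment> \<open>\<open>onorm_bound\<close> needs a nonnegative factor; it is read off at the
      nonzero vector \<open>x - y\<close>, which is why \<open>x = y\<close> is split off.\<close>
    have "0 \<le> (1 - \<tau> * (2 - L * \<theta>) * \<alpha>) * norm (x - y)"
      using S[of "x - y"] norm_ge_zero order_trans by blast
    then have "0 \<le> 1 - \<tau> * (2 - L * \<theta>) * \<alpha>"
      using False by (simp add: zero_le_mult_iff)
    then show "onorm S \<le> 1 - \<tau> * (2 - L * \<theta>) * \<alpha>"
      using S by (rule onorm_bound)
  qed
qed simp

end

section \<open>The smallness threshold and the decay of the parameters\<close>

text \<open>\<open>L * C0_hat L w\<close> depends on \<open>t = L * norm w\<close> only. Isolating
  the root and squaring turns \<open>L * C0_hat L w < 1\<close> into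
  \<open>8 t^3 + 18 t^2 + 3 t < 3\<close>, which explains the cubic defining
  \<open>t0\<close>.\<close>

lemma C0_hat_less:
  fixes w :: "'a::real_normed_vector"
  assumes "L > 0" "8 * t0 ^ 3 + 18 * t0 ^ 2 + 3 * t0 - 3 = 0" "L * norm w < t0"
  shows "L * norm w < 1" "L * C0_hat L w < 1"
proof -
  define W t a where "W = norm w" and "t = L * W" and "a = 1 - t"
  have "t \<ge> 0" "t < t0" using assms by (auto simp: t_def W_def)
  then have "t ^ 3 \<le> t0 ^ 3" "t\<^sup>2 \<le> t0\<^sup>2" by (auto intro: power_mono)
  then have cubic: "8 * t ^ 3 + 18 * t\<^sup>2 + 3 * t < 3"
    using assms(2) \<open>t < t0\<close> by linarith
  have "t\<^sup>2 \<ge> 0" "t ^ 3 \<ge> 0" using \<open>t \<ge> 0\<close> by auto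
  then have "t < 1" using cubic by linarith
  then show "L * norm w < 1" by (simp add: t_def W_def)
  have "a > 0" using \<open>t < 1\<close> by (simp add: a_def)
  have "a > t\<^sup>2" using cubic \<open>t\<^sup>2 \<ge> 0\<close> \<open>t ^ 3 \<ge> 0\<close> unfolding a_def by linarith
  let ?X = "L\<^sup>2 * W ^ 4 + a * (4 * W\<^sup>2 + 8 / 3 * L * W ^ 3)"
  have "L\<^sup>2 * ?X = t ^ 4 + a * (4 * t\<^sup>2 + 8 / 3 * t ^ 3)"
    by (simp add: t_def power_mult_distrib power2_eq_square power3_eq_cube power4_eq_xxxx algebra_simps)
  also have "\<dots> < t ^ 4 + a * (a - 2 * t\<^sup>2)"
    using cubic \<open>a > 0\<close> by (intro add_strict_left_mono mult_strict_left_mono) (auto simp: a_def)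
  also have "\<dots> = (a - t\<^sup>2)\<^sup>2"
    by (simp add: power2_eq_square power4_eq_xxxx algebra_simps)
  finally have "sqrt (L\<^sup>2 * ?X) < a - t\<^sup>2"
    using \<open>a > t\<^sup>2\<close> by (intro real_less_lsqrt) auto
  then have "L * sqrt ?X + t\<^sup>2 < a"
    using \<open>L > 0\<close> by (simp add: real_sqrt_mult)
  then have "(L * (L * W\<^sup>2 + sqrt ?X)) / a < 1"
    using \<open>a > 0\<close> by (simp add: t_def power2_eq_square algebra_simps)
  then show "L * C0_hat L w < 1"
    by (simp add: C0_hat_def a_def t_def W_def)
qed

lemma reg_param_pos: "\<alpha>0 > 0 \<Longrightarrow> k \<ge> 1 \<Longrightarrow> reg_param \<alpha>0 s k n > 0"
  by (simp add: reg_param_def)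

lemma reg_param_tendsto_0:
  assumes "s > 0"
  shows "reg_param \<alpha>0 s k \<longlonglongrightarrow> 0"
proof -
  have "(\<lambda>n. real (n + k) powr (- s)) \<longlonglongrightarrow> 0"
    using assms by (intro tendsto_neg_powr filterlim_compose[OF filterlim_real_sequentially] filterlim_add_const_nat_at_top) auto
  from tendsto_mult_right_zero[OF this, of \<alpha>0] show ?thesis
    by (simp add: reg_param_def[abs_def])
qed

text \<open>After division by \<open>t powr (- s)\<close> this is the Bernoulli type bound
  \<open>1 - s / t \<le> (1 + 1 / t) powr (- s)\<close>.\<close>

lemma powr_neg_diff_le:
  fixes t s :: real
  assumes "t > 0" "s \<ge> 0"
  shows "t powr (- s) - (t + 1) powr (- s) \<le> s * t powr (- s - 1)"
proof -
  have "1 + 1 / t > 0"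
    using \<open>t > 0\<close> by (simp add: add_pos_pos)
  then have ne: "1 + 1 / t \<noteq> 0"
    by simp
  have "ln (1 + 1 / t) \<le> 1 / t"
    using assms by (intro ln_add_one_self_le_self) auto
  then have "s * ln (1 + 1 / t) \<le> s * (1 / t)"
    using \<open>s \<ge> 0\<close> by (rule mult_left_mono)
  then have "1 - s / t \<le> 1 + (- s * ln (1 + 1 / t))" by simp
  also have "\<dots> \<le> exp (- s * ln (1 + 1 / t))" by (rule exp_ge_add_one_self)
  also have "\<dots> = (1 + 1 / t) powr (- s)"
    by (simp only: powr_def ne if_False)
  finally have "t powr (- s) * (1 - s / t) \<le> t powr (- s) * (1 + 1 / t) powr (- s)"
    by (intro mult_left_mono) auto
  also have "\<dots> = (t * (1 + 1 / t)) powr (- s)"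
    using \<open>t > 0\<close> by (subst powr_mult) auto
  also have "t * (1 + 1 / t) = t + 1"
    using \<open>t > 0\<close> by (simp add: field_simps)
  finally show ?thesis
    using \<open>t > 0\<close> by (simp add: powr_diff algebra_simps)
qed

lemma reg_param_antimono:
  assumes "\<alpha>0 > 0" "s > 0" "k \<ge> 1"
  shows "reg_param \<alpha>0 s k (n + 1) \<le> reg_param \<alpha>0 s k n"
  unfolding reg_param_def using assms by (intro mult_left_mono powr_mono2') auto

text \<open>With \<open>t = n + k\<close>, the decrement is of order \<open>t powr (- s - 1)\<close>
  and the right side of order \<open>t powr (- 7/2 s)\<close>. Their quotient
  \<open>t powr (5/2 s - 1)\<close> tends to 0 because \<open>s < 2/5\<close>. Everything depends on
  \<open>n + k\<close>, so a large shift \<open>k\<close> serves all \<open>n\<close> at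
  once.\<close>

lemma reg_param_eventually:
  assumes "\<alpha>0 > 0" "0 < s" "s < 2 / 5" "\<epsilon> > 0" "c > 0"
  shows "\<exists>k0\<ge>1. \<forall>k\<ge>k0. \<forall>n. reg_param \<alpha>0 s k n \<le> \<epsilon> \<and>
    reg_param \<alpha>0 s k n - reg_param \<alpha>0 s k (n + 1)
      \<le> c * reg_param \<alpha>0 s k n ^ 3 * sqrt (reg_param \<alpha>0 s k n)"
proof -
  \<comment> \<open>Chosen so that \<open>\<alpha>0 * s * C\<close> equals \<open>c\<close> times
    \<open>\<alpha>0\<close> to the power 7/2.\<close>
  define C where "C = c * \<alpha>0 ^ 2 * sqrt \<alpha>0 / s"
  have "C > 0" using assms by (simp add: C_def)
  have "(\<lambda>t. real t powr (- s)) \<longlonglongrightarrow> 0"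
    using assms by (intro tendsto_neg_powr filterlim_real_sequentially) auto
  moreover have "(\<lambda>t. real t powr (5 / 2 * s - 1)) \<longlonglongrightarrow> 0"
    using assms by (intro tendsto_neg_powr filterlim_real_sequentially) auto
  ultimately have "eventually (\<lambda>t. real t powr (- s) < \<epsilon> / \<alpha>0 \<and> real t powr (5 / 2 * s - 1) < C) sequentially"
    using \<open>C > 0\<close> assms by (intro eventually_conj order_tendstoD(2)[of _ 0]) auto
  then obtain T where T: "\<And>t. t \<ge> T \<Longrightarrow> real t powr (- s) < \<epsilon> / \<alpha>0"
      "\<And>t. t \<ge> T \<Longrightarrow> real t powr (5 / 2 * s - 1) < C"
    by (auto simp: eventually_sequentially)
  have "reg_param \<alpha>0 s k n \<le> \<epsilon> \<and> reg_param \<alpha>0 s k n - reg_param \<alpha>0 s k (n + 1)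
      \<le> c * reg_param \<alpha>0 s k n ^ 3 * sqrt (reg_param \<alpha>0 s k n)" if "k \<ge> max 1 T" for k n
  proof
    define t where "t = real (n + k)"
    have "t > 0" using that by (simp add: t_def)
    have rp: "reg_param \<alpha>0 s k n = \<alpha>0 * t powr (- s)" "reg_param \<alpha>0 s k (n + 1) = \<alpha>0 * (t + 1) powr (- s)"
      by (simp_all add: reg_param_def t_def algebra_simps)
    show "reg_param \<alpha>0 s k n \<le> \<epsilon>"
      using T(1)[of "n + k"] that \<open>\<alpha>0 > 0\<close> by (simp add: rp t_def field_simps)
    have "\<alpha>0 * (t powr (- s) - (t + 1) powr (- s)) \<le> \<alpha>0 * (s * t powr (- s - 1))"
      using powr_neg_diff_le[OF \<open>t > 0\<close>, of s] assms by (intro mult_left_mono) auto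
    also have "t powr (- s - 1) = t powr (5 / 2 * s - 1) * t powr (- (7 / 2 * s))"
      by (simp flip: powr_add)
    also have "\<alpha>0 * (s * (t powr (5 / 2 * s - 1) * t powr (- (7 / 2 * s))))
        \<le> \<alpha>0 * (s * (C * t powr (- (7 / 2 * s))))"
      using T(2)[of "n + k"] that assms by (intro mult_left_mono mult_right_mono) (auto simp: t_def)
    also have "t powr (- (7 / 2 * s)) = (t powr (- s)) ^ 3 * sqrt (t powr (- s))"
      using \<open>t > 0\<close> by (simp add: powr_power powr_powr flip: powr_half_sqrt powr_add)
    also have "\<alpha>0 * (s * (C * ((t powr (- s)) ^ 3 * sqrt (t powr (- s)))))
        = c * (\<alpha>0 * t powr (- s)) ^ 3 * sqrt (\<alpha>0 * t powr (- s))"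
      using \<open>s > 0\<close> by (simp add: C_def real_sqrt_mult power_mult_distrib power2_eq_square power3_eq_cube)
    finally show "reg_param \<alpha>0 s k n - reg_param \<alpha>0 s k (n + 1)
        \<le> c * reg_param \<alpha>0 s k n ^ 3 * sqrt (reg_param \<alpha>0 s k n)"
      by (simp only: rp right_diff_distrib)
  qed
  then show ?thesis by (intro exI[of _ "max 1 T"]) auto
qed

text \<open>The fraction 3/4 is 1/4 + 1/2: the second entry of the maximum bounds \<open>c6\<close>
  by a quarter of \<open>\<kappa> * c4 * K1^2\<close>, and the first, with
  \<open>c7 \<ge> 1\<close>, bounds \<open>\<kappa> * \<alpha>bar\<close> by half of it.\<close>

lemma noise_le:
  assumes "\<kappa> > 0" "c4 > 0" "c6 \<ge> 1" "\<alpha>bar > 0" "\<delta> > 0"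
    and c7: "c7 = c6 + \<kappa> * \<alpha>bar"
    and K1: "K1 \<ge> sqrt (max (2 * c7 * \<alpha>bar / c4) (4 * c6 / (\<kappa> * c4)))"
    and a: "a > K1 * sqrt \<delta>"
  shows "\<delta> * c7 \<le> 3 / 4 * \<kappa> * c4 * a\<^sup>2"
proof -
  have K1_sq: "max (2 * c7 * \<alpha>bar / c4) (4 * c6 / (\<kappa> * c4)) \<le> K1\<^sup>2"
    using K1 by (rule sqrt_le_D)
  have "0 < 4 * c6 / (\<kappa> * c4)" using assms by simp
  then have "K1 \<ge> 0"
    by (intro order_trans[OF _ K1]) (simp add: le_max_iff_disj)
  have 1: "4 * c6 \<le> \<kappa> * c4 * K1\<^sup>2" and 2: "2 * c7 * \<alpha>bar \<le> c4 * K1\<^sup>2"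
    using K1_sq assms by (auto simp: field_simps)
  have "1 \<le> c7" using assms by (simp add: c7 add_increasing2)
  then have "2 * \<alpha>bar \<le> 2 * c7 * \<alpha>bar" using \<open>\<alpha>bar > 0\<close> by simp
  then have "\<kappa> * (2 * \<alpha>bar) \<le> \<kappa> * (c4 * K1\<^sup>2)"
    using 2 \<open>\<kappa> > 0\<close> by (intro mult_left_mono) auto
  then have "c7 \<le> 3 / 4 * \<kappa> * c4 * K1\<^sup>2"
    using 1 unfolding c7 by (simp add: algebra_simps)
  then have "\<delta> * c7 \<le> \<delta> * (3 / 4 * \<kappa> * c4 * K1\<^sup>2)"
    using \<open>\<delta> > 0\<close> by simp
  also have "\<dots> = 3 / 4 * \<kappa> * c4 * (K1 * sqrt \<delta>)\<^sup>2"
    using \<open>\<delta> > 0\<close> by (simp add: power_mult_distrib)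
  also have "\<dots> \<le> 3 / 4 * \<kappa> * c4 * a\<^sup>2"
    using assms \<open>K1 \<ge> 0\<close> by (intro mult_left_mono power_mono) auto
  finally show ?thesis .
qed

section \<open>The perturbed iteration up to the stopping index\<close>

context source_condition
begin

text \<open>Budget of one step: contraction gains \<open>\<mu> \<kappa> m \<alpha>^3\<close> with
  \<open>m = 2 - L (\<kappa> + C0)\<close>. Noise may spend three quarters of it; the last quarter
  pays for the shift of the regularized point and the shrinking of the radius from
  \<open>\<kappa> \<alpha>\<close> to \<open>\<kappa> \<beta>\<close>.\<close>

lemma gradient_step:
  assumes \<kappa>: "\<kappa> > 0" "L * (\<kappa> + C0) < 2" and "\<mu> > 0" and \<alpha>: "0 < \<beta>" "\<beta> \<le> \<alpha>" "\<alpha> \<le> 1"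
    and small: "\<mu> * \<alpha> * (norm (J'' xstar) + 4) \<le> 1"
    and gap: "(\<kappa> + drift) * (\<alpha> - \<beta>) \<le> \<mu> * \<kappa> * (2 - L * (\<kappa> + C0)) / 4 * \<alpha> ^ 3 * sqrt \<alpha>"
    and x: "norm (x - reg_point \<alpha>) \<le> \<kappa> * \<alpha>"
    and g: "norm (g - J' x) \<le> 3 / 4 * \<kappa> * (2 - L * (\<kappa> + C0)) * \<alpha>\<^sup>2"
  shows "norm (x - (\<mu> * \<alpha>) *\<^sub>R (g + (2 * \<alpha>) *\<^sub>R (x - \<xi>)) - reg_point \<beta>) \<le> \<kappa> * \<beta>"
proof -
  define \<theta> m y \<tau> where "\<theta> = \<kappa> + C0" and "m = 2 - L * \<theta>" and "y = reg_point \<alpha>" and "\<tau> = \<mu> * \<alpha>"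
  define h where "h = norm (y - reg_point \<beta>)"
  have "\<alpha> > 0" "m > 0" "\<tau> > 0" "\<theta> > 0"
    using \<alpha> \<kappa> \<open>\<mu> > 0\<close> C0_nonneg by (auto simp: m_def \<theta>_def \<tau>_def)
  have y: "norm (y - xstar) \<le> C0 * \<alpha>" "tikhonov_grad \<alpha> y = 0"
    using reg_point[OF \<open>\<alpha> > 0\<close>] by (auto simp: y_def)
  have "(L * \<theta> + 2) * \<alpha> \<le> 4 * 1"
    using \<kappa>(2) \<open>\<alpha> > 0\<close> \<open>\<alpha> \<le> 1\<close> by (intro mult_mono) (auto simp: \<theta>_def)
  then have "\<tau> * (norm (J'' xstar) + (L * \<theta> + 2) * \<alpha>) \<le> \<tau> * (norm (J'' xstar) + 4)"
    using \<open>\<tau> > 0\<close> by simp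
  with small have \<tau>: "\<tau> * (norm (J'' xstar) + (L * \<theta> + 2) * \<alpha>) \<le> 1"
    by (simp add: \<tau>_def)
  have "norm (x - xstar) \<le> norm (x - y) + norm (y - xstar)"
    using norm_triangle_ineq[of "x - y" "y - xstar"] by simp
  then have "norm (x - xstar) \<le> \<theta> * \<alpha>"
    using x y(1) by (simp add: y_def \<theta>_def algebra_simps)
  moreover have "norm (y - xstar) \<le> \<theta> * \<alpha>"
    using y(1) mult_pos_pos[OF \<kappa>(1) \<open>\<alpha> > 0\<close>] by (simp add: \<theta>_def distrib_right)
  ultimately have mem: "x \<in> cball xstar (\<theta> * \<alpha>)" "y \<in> cball xstar (\<theta> * \<alpha>)"
    by (auto simp: dist_norm norm_minus_commute)
  have "m * \<alpha> \<le> norm (J'' xstar) + (L * \<theta> + 2) * \<alpha>"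
    using L_pos \<open>\<theta> > 0\<close> \<open>\<alpha> > 0\<close> by (simp add: m_def algebra_simps add_increasing2)
  then have "\<tau> * (m * \<alpha>) \<le> \<tau> * (norm (J'' xstar) + (L * \<theta> + 2) * \<alpha>)"
    using \<open>\<tau> > 0\<close> by simp
  then have factor: "0 \<le> 1 - \<tau> * m * \<alpha>" using \<tau> by simp
  have "norm ((x - \<tau> *\<^sub>R tikhonov_grad \<alpha> x) - (y - \<tau> *\<^sub>R tikhonov_grad \<alpha> y)) \<le> (1 - \<tau> * m * \<alpha>) * norm (x - y)"
    unfolding m_def using gradient_step_contraction[OF \<open>\<alpha> > 0\<close> _ \<tau> mem] \<open>\<tau> > 0\<close> by simp
  also have "\<dots> \<le> (1 - \<tau> * m * \<alpha>) * (\<kappa> * \<alpha>)"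
    using x factor by (intro mult_left_mono) (auto simp: y_def)
  finally have 1: "norm ((x - \<tau> *\<^sub>R tikhonov_grad \<alpha> x) - y) \<le> (1 - \<tau> * m * \<alpha>) * (\<kappa> * \<alpha>)"
    by (simp add: y(2))
  have "\<tau> * norm (g - J' x) \<le> \<tau> * (3 / 4 * \<kappa> * m * \<alpha>\<^sup>2)"
    using g \<open>\<tau> > 0\<close> by (simp add: m_def \<theta>_def)
  then have 2: "norm (\<tau> *\<^sub>R (g - J' x)) \<le> \<tau> * (3 / 4 * \<kappa> * m * \<alpha>\<^sup>2)"
    using \<open>\<tau> > 0\<close> by simp
  have "sqrt \<alpha> * h \<le> drift * (\<alpha> - \<beta>)"
    using reg_point_diff[OF \<alpha>] by (simp add: h_def y_def)
  \<comment> \<open>The factor \<open>sqrt \<alpha> \<le> 1\<close> brings the radius loss to the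
    scale of the drift bound, so that \<open>gap\<close> covers both.\<close>
  moreover have "sqrt \<alpha> * (\<kappa> * (\<alpha> - \<beta>)) \<le> 1 * (\<kappa> * (\<alpha> - \<beta>))"
    using \<alpha> \<kappa> by (intro mult_right_mono) auto
  ultimately have "sqrt \<alpha> * (\<kappa> * (\<alpha> - \<beta>) + h) \<le> (\<kappa> + drift) * (\<alpha> - \<beta>)"
    by (simp add: algebra_simps)
  also have "\<dots> \<le> sqrt \<alpha> * (\<mu> * \<kappa> * m / 4 * \<alpha> ^ 3)"
    using gap by (simp add: m_def \<theta>_def ac_simps)
  finally have 3: "\<kappa> * (\<alpha> - \<beta>) + h \<le> \<mu> * \<kappa> * m / 4 * \<alpha> ^ 3"
    using \<open>\<alpha> > 0\<close> by simp
  have "x - \<tau> *\<^sub>R (g + (2 * \<alpha>) *\<^sub>R (x - \<xi>)) - reg_point \<beta>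
      = ((x - \<tau> *\<^sub>R tikhonov_grad \<alpha> x) - y) - \<tau> *\<^sub>R (g - J' x) + (y - reg_point \<beta>)"
    by (simp add: tikhonov_grad_def algebra_simps)
  also have "norm \<dots> \<le> norm ((x - \<tau> *\<^sub>R tikhonov_grad \<alpha> x) - y) + norm (\<tau> *\<^sub>R (g - J' x)) + h"
    unfolding h_def by (intro order_trans[OF norm_triangle_ineq] add_right_mono norm_triangle_ineq4)
  also have "\<dots> \<le> (1 - \<tau> * m * \<alpha>) * (\<kappa> * \<alpha>) + \<tau> * (3 / 4 * \<kappa> * m * \<alpha>\<^sup>2)
      + (\<mu> * \<kappa> * m / 4 * \<alpha> ^ 3 - \<kappa> * (\<alpha> - \<beta>))"
    using 1 2 3 by linarith
  also have "\<dots> = \<kappa> * \<beta>"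
    by (simp add: \<tau>_def power2_eq_square power3_eq_cube field_simps)
  finally show ?thesis by (simp add: \<tau>_def)
qed

end

theorem theorem4p1:
  fixes J :: "'a::{real_inner,complete_space} \<Rightarrow> real"
    and J' :: "'a \<Rightarrow> 'a" and J'' :: "'a \<Rightarrow> 'a \<Rightarrow>\<^sub>L 'a"
    and xstar \<xi> w :: 'a and L t0 C0 :: real
  assumes "C2_gradient J J' J''"
    and "\<forall>x. J xstar \<le> J x"
    and "L > 0"
    and "\<forall>x y. norm (J'' x - J'' y) \<le> L * norm (x - y)"
    and "xstar - \<xi> = blinfun_apply (J'' xstar) w"
    and "t0 > 0" and "8 * t0 ^ 3 + 18 * t0 ^ 2 + 3 * t0 - 3 = 0"
    and "L * norm w < t0"
    and "C0 = C0_hat L w"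
  shows "(\<exists>\<kappa>. C0 < \<kappa> \<and> \<kappa> < 2 / L - C0) \<and>
    (\<forall>\<kappa> \<alpha>bar \<mu> \<alpha>0 s.
      C0 < \<kappa> \<and> \<kappa> < 2 / L - C0 \<and> \<alpha>bar > 0 \<and> \<mu> > 0 \<and> \<alpha>0 > 0 \<and> 0 < s \<and> s < 2 / 5 \<longrightarrow>
      (\<exists>k0::nat. k0 \<ge> 1 \<and> (\<forall>k\<ge>k0. \<forall>\<alpha>. \<alpha> = reg_param \<alpha>0 s k \<longrightarrow>
        (\<forall>\<delta> J\<delta> J\<delta>' J\<delta>'' x.
          \<delta> \<ge> 0 \<and> C2_gradient J\<delta> J\<delta>' J\<delta>'' \<and>
          (\<forall>y. norm (J\<delta>' y - J' y) \<le> \<delta> * (1 + norm (y - \<xi>))) \<and>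
          (\<forall>y. norm (J\<delta>'' y - J'' y) \<le> \<delta> * (1 + norm (y - \<xi>))) \<and>
          (\<delta> = 0 \<longrightarrow> J\<delta> = J) \<and>
          norm (x 1 - xstar) \<le> (\<kappa> - C0) * \<alpha> 1 \<and>
          reg_gradient_iteration J\<delta>' \<xi> \<mu> \<alpha> x \<longrightarrow>
          (\<delta> = 0 \<longrightarrow> (\<forall>n\<ge>1. norm (x n - xstar) \<le> (\<kappa> + C0) * \<alpha> n)) \<and>
          (\<delta> > 0 \<longrightarrow> (\<forall>K1 N.
            K1 \<ge> sqrt (max (2 * C7 xstar \<xi> \<kappa> C0 \<alpha>bar * \<alpha>bar / C4 L \<kappa> C0)
                             (4 * C6 xstar \<xi> C0 \<alpha>bar / (\<kappa> * C4 L \<kappa> C0))) \<and>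
            N = (LEAST n. n \<ge> 1 \<and> \<alpha> n \<le> K1 * sqrt \<delta>) \<longrightarrow>
            norm (x N - xstar) \<le> (\<kappa> + C0) * K1 * sqrt \<delta>))))))"
proof (intro conjI allI impI)
  have C0_small: "L * C0 < 1" and w_small: "L * norm w < 1"
    using C0_hat_less[OF assms(3,7,8)] assms(9) by auto
  interpret source_condition J J' J'' L xstar \<xi> w C0
    using assms C0_small w_small by unfold_locales (auto simp: C2_gradient_def)
  show "\<exists>\<kappa>. C0 < \<kappa> \<and> \<kappa> < 2 / L - C0"
    using C0_small L_pos by (intro dense) (simp add: field_simps)
  fix \<kappa> \<alpha>bar \<mu> \<alpha>0 s :: real
  assume *: "C0 < \<kappa> \<and> \<kappa> < 2 / L - C0 \<and> \<alpha>bar > 0 \<and> \<mu> > 0 \<and> \<alpha>0 > 0 \<and> 0 < s \<and> s < 2 / 5"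
  then have "C0 < \<kappa>" "\<alpha>bar > 0" "\<mu> > 0" "\<alpha>0 > 0" "0 < s" "s < 2 / 5" by auto
  have "\<kappa> > 0" using \<open>C0 < \<kappa>\<close> C0_nonneg by linarith
  have \<kappa>_upper: "L * (\<kappa> + C0) < 2" using * L_pos by (simp add: field_simps)
  define m where "m = C4 L \<kappa> C0"
  have m: "m = 2 - L * (\<kappa> + C0)" "m > 0" using \<kappa>_upper by (auto simp: m_def C4_def)
  \<comment> \<open>The three bounds serve \<open>reg_point_diff\<close>, the constant
    \<open>C7\<close>, and the step size condition; \<open>c\<close> below is solved from the
    hypothesis \<open>gap\<close> of \<open>gradient_step\<close>.\<close>
  define \<epsilon> where "\<epsilon> = min (min 1 \<alpha>bar) (1 / (\<mu> * (norm (J'' xstar) + 4)))"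
  define c where "c = \<mu> * \<kappa> * m / 4 / (\<kappa> + drift)"
  have "norm (J'' xstar) + 4 > 0" by (intro add_nonneg_pos) auto
  then have "\<epsilon> > 0" using \<open>\<mu> > 0\<close> \<open>\<alpha>bar > 0\<close> by (simp add: \<epsilon>_def)
  have "\<kappa> + drift > 0" using \<open>\<kappa> > 0\<close> drift_nonneg by linarith
  then have "c > 0" using \<open>\<mu> > 0\<close> \<open>\<kappa> > 0\<close> m by (simp add: c_def)
  \<comment> \<open>\<open>k0\<close> is fixed before \<open>\<delta>\<close> and the perturbed
    functional appear, which gives the required independence.\<close>
  obtain k0 where "k0 \<ge> 1" and k0: "\<And>k n. k \<ge> k0 \<Longrightarrow> reg_param \<alpha>0 s k n \<le> \<epsilon>"
      "\<And>k n. k \<ge> k0 \<Longrightarrow> reg_param \<alpha>0 s k n - reg_param \<alpha>0 s k (n + 1)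
        \<le> c * reg_param \<alpha>0 s k n ^ 3 * sqrt (reg_param \<alpha>0 s k n)"
    using reg_param_eventually[OF \<open>\<alpha>0 > 0\<close> \<open>0 < s\<close> \<open>s < 2 / 5\<close> \<open>\<epsilon> > 0\<close> \<open>c > 0\<close>] by blast
  have main: "(\<delta> = 0 \<longrightarrow> (\<forall>n\<ge>1. norm (x n - xstar) \<le> (\<kappa> + C0) * \<alpha> n)) \<and>
      (\<delta> > 0 \<longrightarrow> (\<forall>K1 N.
        K1 \<ge> sqrt (max (2 * C7 xstar \<xi> \<kappa> C0 \<alpha>bar * \<alpha>bar / C4 L \<kappa> C0)
                         (4 * C6 xstar \<xi> C0 \<alpha>bar / (\<kappa> * C4 L \<kappa> C0))) \<and>
        N = (LEAST n. n \<ge> 1 \<and> \<alpha> n \<le> K1 * sqrt \<delta>) \<longrightarrow>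
        norm (x N - xstar) \<le> (\<kappa> + C0) * K1 * sqrt \<delta>))"
    if "k \<ge> k0" and \<alpha>: "\<alpha> = reg_param \<alpha>0 s k"
      and J\<delta>': "\<And>y. norm (J\<delta>' y - J' y) \<le> \<delta> * (1 + norm (y - \<xi>))"
      and start: "norm (x 1 - xstar) \<le> (\<kappa> - C0) * \<alpha> 1"
      and iter: "reg_gradient_iteration J\<delta>' \<xi> \<mu> \<alpha> x" and "\<delta> \<ge> 0"
    for k \<alpha> \<delta> J\<delta>' and x :: "nat \<Rightarrow> 'a"
  proof -
    have "k \<ge> 1" using \<open>k \<ge> k0\<close> \<open>k0 \<ge> 1\<close> by simp
    have pos: "\<alpha> n > 0" for n
      unfolding \<alpha> using reg_param_pos \<open>\<alpha>0 > 0\<close> \<open>k \<ge> 1\<close> by blast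
    have anti: "\<alpha> (n + 1) \<le> \<alpha> n" for n
      unfolding \<alpha> by (rule reg_param_antimono) fact+
    have "\<alpha> n \<le> \<epsilon>" for n
      unfolding \<alpha> by (rule k0) fact
    then have le1: "\<alpha> n \<le> 1" and le_bar: "\<alpha> n \<le> \<alpha>bar"
        and "\<alpha> n \<le> 1 / (\<mu> * (norm (J'' xstar) + 4))" for n
      by (auto simp: \<epsilon>_def)
    then have small: "\<mu> * \<alpha> n * (norm (J'' xstar) + 4) \<le> 1" for n
      using \<open>\<mu> > 0\<close> \<open>norm (J'' xstar) + 4 > 0\<close> by (simp add: pos_le_divide_eq ac_simps)
    have gap: "(\<kappa> + drift) * (\<alpha> n - \<alpha> (n + 1)) \<le> \<mu> * \<kappa> * m / 4 * \<alpha> n ^ 3 * sqrt (\<alpha> n)" for n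
    proof -
      have "(\<kappa> + drift) * (\<alpha> n - \<alpha> (n + 1)) \<le> (\<kappa> + drift) * (c * \<alpha> n ^ 3 * sqrt (\<alpha> n))"
        unfolding \<alpha> using k0(2)[OF \<open>k \<ge> k0\<close>] \<open>\<kappa> + drift > 0\<close> by (intro mult_left_mono) auto
      also have "\<dots> = ((\<kappa> + drift) * c) * \<alpha> n ^ 3 * sqrt (\<alpha> n)" by simp
      also have "(\<kappa> + drift) * c = \<mu> * \<kappa> * m / 4"
        using iffD1[OF nonzero_eq_divide_eq c_def] \<open>\<kappa> + drift > 0\<close> by (simp only: mult.commute)
      finally show ?thesis .
    qed
    have near: "norm (y - xstar) \<le> (\<kappa> + C0) * \<alpha> n" if "norm (y - reg_point (\<alpha> n)) \<le> \<kappa> * \<alpha> n" for y n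
      using that reg_point(1)[OF pos, of n] norm_triangle_ineq[of "y - reg_point (\<alpha> n)" "reg_point (\<alpha> n) - xstar"]
      by (simp add: distrib_right)
    define c7 where "c7 = C7 xstar \<xi> \<kappa> C0 \<alpha>bar"
    \<comment> \<open>The noise condition is demanded only for indices before \<open>n\<close>, so
      the invariant still reaches the stopping index itself, where that condition may fail.\<close>
    have invariant: "norm (x n - reg_point (\<alpha> n)) \<le> \<kappa> * \<alpha> n"
      if "n \<ge> 1" and noise: "\<And>i. 1 \<le> i \<Longrightarrow> i < n \<Longrightarrow> \<delta> * c7 \<le> 3 / 4 * \<kappa> * m * (\<alpha> i)\<^sup>2" for n
      using that
    proof (induction n rule: nat_induct_at_least)
      case base
      show ?case
        \<comment> \<open>The radius \<open>\<kappa> - C0\<close> around \<open>xstar\<close> leaves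
          exactly \<open>C0\<close> for the distance from \<open>xstar\<close> to the regularized
          point.\<close>
        using start reg_point(1)[OF pos, of 1] norm_triangle_ineq[of "x 1 - xstar" "xstar - reg_point (\<alpha> 1)"]
        by (simp add: norm_minus_commute left_diff_distrib)
    next
      case (Suc n)
      then have IH: "norm (x n - reg_point (\<alpha> n)) \<le> \<kappa> * \<alpha> n" by simp
      have "norm (x n - \<xi>) \<le> norm (x n - xstar) + norm (xstar - \<xi>)"
        using norm_triangle_ineq[of "x n - xstar" "xstar - \<xi>"] by simp
      moreover have "norm (x n - xstar) \<le> (\<kappa> + C0) * \<alpha>bar"
        using near[OF IH] mult_left_mono[OF le_bar[of n], of "\<kappa> + C0"] \<open>\<kappa> > 0\<close> C0_nonneg by linarith
      ultimately have "1 + norm (x n - \<xi>) \<le> c7"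
        by (simp add: c7_def C7_def)
      then have "\<delta> * (1 + norm (x n - \<xi>)) \<le> \<delta> * c7"
        using \<open>\<delta> \<ge> 0\<close> by (rule mult_left_mono)
      then have "norm (J\<delta>' (x n) - J' (x n)) \<le> 3 / 4 * \<kappa> * m * (\<alpha> n)\<^sup>2"
        using J\<delta>'[of "x n"] Suc.prems[of n] Suc.hyps by linarith
      then have "norm (x n - (\<mu> * \<alpha> n) *\<^sub>R (J\<delta>' (x n) + (2 * \<alpha> n) *\<^sub>R (x n - \<xi>)) - reg_point (\<alpha> (n + 1)))
          \<le> \<kappa> * \<alpha> (n + 1)"
        using gradient_step[OF \<open>\<kappa> > 0\<close> \<kappa>_upper \<open>\<mu> > 0\<close> pos anti le1 small _ IH] gap[of n]
        unfolding m by blast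
      then show ?case
        using iter Suc.hyps by (simp add: reg_gradient_iteration_def)
    qed
    show ?thesis
    proof (intro conjI impI allI)
      fix n :: nat assume "\<delta> = 0" "1 \<le> n"
      then show "norm (x n - xstar) \<le> (\<kappa> + C0) * \<alpha> n"
        using \<open>\<kappa> > 0\<close> m by (intro near invariant) auto
    next
      fix K1 N
      assume "\<delta> > 0" and K1N: "K1 \<ge> sqrt (max (2 * C7 xstar \<xi> \<kappa> C0 \<alpha>bar * \<alpha>bar / C4 L \<kappa> C0)
                         (4 * C6 xstar \<xi> C0 \<alpha>bar / (\<kappa> * C4 L \<kappa> C0))) \<and>
        N = (LEAST n. n \<ge> 1 \<and> \<alpha> n \<le> K1 * sqrt \<delta>)"
      let ?P = "\<lambda>n. n \<ge> 1 \<and> \<alpha> n \<le> K1 * sqrt \<delta>"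
      have c6: "C6 xstar \<xi> C0 \<alpha>bar \<ge> 1"
        using C0_nonneg \<open>\<alpha>bar > 0\<close> by (simp add: C6_def)
      have c7: "c7 = C6 xstar \<xi> C0 \<alpha>bar + \<kappa> * \<alpha>bar"
        by (simp add: c7_def C7_def C6_def algebra_simps)
      \<comment> \<open>Positivity of \<open>K1\<close> makes the stopping threshold positive; since
        the parameters tend to 0, the least index in the definition of \<open>N\<close>
        exists.\<close>
      have "0 < 4 * C6 xstar \<xi> C0 \<alpha>bar / (\<kappa> * m)" using c6 \<open>\<kappa> > 0\<close> m(2) by simp
      then have "0 < sqrt (max (2 * c7 * \<alpha>bar / m) (4 * C6 xstar \<xi> C0 \<alpha>bar / (\<kappa> * m)))"
        unfolding real_sqrt_gt_0_iff less_max_iff_disj ..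
      then have "K1 > 0"
        using K1N unfolding m_def c7_def by linarith
      then have "K1 * sqrt \<delta> > 0" using \<open>\<delta> > 0\<close> by simp
      then have "eventually (\<lambda>n. \<alpha> n < K1 * sqrt \<delta>) sequentially"
        using reg_param_tendsto_0[OF \<open>0 < s\<close>] unfolding \<alpha> by (rule order_tendstoD(2)[rotated])
      then have "eventually ?P sequentially"
        using eventually_ge_at_top[of 1] by eventually_elim auto
      then have "\<exists>n. ?P n" by (auto simp: eventually_sequentially)
      then have N: "?P N" using K1N LeastI_ex[of ?P] by blast
      have "\<delta> * c7 \<le> 3 / 4 * \<kappa> * m * (\<alpha> i)\<^sup>2" if "1 \<le> i" "i < N" for i
      proof (rule noise_le[OF \<open>\<kappa> > 0\<close> m(2) c6 \<open>\<alpha>bar > 0\<close> \<open>\<delta> > 0\<close> c7])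
        show "K1 \<ge> sqrt (max (2 * c7 * \<alpha>bar / m) (4 * C6 xstar \<xi> C0 \<alpha>bar / (\<kappa> * m)))"
          using K1N by (simp add: c7_def m_def)
        show "\<alpha> i > K1 * sqrt \<delta>"
          using not_less_Least[of i ?P] that K1N by auto
      qed
      then have "norm (x N - xstar) \<le> (\<kappa> + C0) * \<alpha> N"
        using N by (intro near invariant) auto
      also have "\<dots> \<le> (\<kappa> + C0) * (K1 * sqrt \<delta>)"
        using N \<open>\<kappa> > 0\<close> C0_nonneg by (intro mult_left_mono) auto
      finally show "norm (x N - xstar) \<le> (\<kappa> + C0) * K1 * sqrt \<delta>" by simp
    qed
  qed
  show "\<exists>k0::nat. k0 \<ge> 1 \<and> (\<forall>k\<ge>k0. \<forall>\<alpha>. \<alpha> = reg_param \<alpha>0 s k \<longrightarrow>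
        (\<forall>\<delta> J\<delta> J\<delta>' J\<delta>'' x.
          \<delta> \<ge> 0 \<and> C2_gradient J\<delta> J\<delta>' J\<delta>'' \<and>
          (\<forall>y. norm (J\<delta>' y - J' y) \<le> \<delta> * (1 + norm (y - \<xi>))) \<and>
          (\<forall>y. norm (J\<delta>'' y - J'' y) \<le> \<delta> * (1 + norm (y - \<xi>))) \<and>
          (\<delta> = 0 \<longrightarrow> J\<delta> = J) \<and>
          norm (x 1 - xstar) \<le> (\<kappa> - C0) * \<alpha> 1 \<and>
          reg_gradient_iteration J\<delta>' \<xi> \<mu> \<alpha> x \<longrightarrow>
          (\<delta> = 0 \<longrightarrow> (\<forall>n\<ge>1. norm (x n - xstar) \<le> (\<kappa> + C0) * \<alpha> n)) \<and>
          (\<delta> > 0 \<longrightarrow> (\<forall>K1 N.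
            K1 \<ge> sqrt (max (2 * C7 xstar \<xi> \<kappa> C0 \<alpha>bar * \<alpha>bar / C4 L \<kappa> C0)
                             (4 * C6 xstar \<xi> C0 \<alpha>bar / (\<kappa> * C4 L \<kappa> C0))) \<and>
            N = (LEAST n. n \<ge> 1 \<and> \<alpha> n \<le> K1 * sqrt \<delta>) \<longrightarrow>
            norm (x N - xstar) \<le> (\<kappa> + C0) * K1 * sqrt \<delta>))))"
    by (rule exI[of _ k0], rule conjI[OF \<open>k0 \<ge> 1\<close>], (rule allI impI)+, elim conjE, rule main) blast+
qed

end
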